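(* For any positive constant $A$ there is a positive constant $B$ such that the following holds. For any $0<\mu\le1$ and any sufficiently large $n$ (depending on $A$, $B$ and $\mu$), $$\mathbf P\big(\sigma_n(M_n^\mu)\le n^{-B}\big)\le n^{-A}.$$
   Context: For $0\le\mu\le1$, $\eta^\mu$ is a random variable equal to $0$ with probability $1-\mu$ and to $+1$, $-1$ with probability $\mu/2$ each. $M_n^\mu$ is the $n\times n$ random matrix whose entries are i.i.d. copies of $\eta^\mu$. For an $n\times n$ real matrix $M$, $\sigma_n(M):=\min_{x\in\mathbb R^n,\|x\|=1}\|Mx\|$ is the smallest singular value (Euclidean norms). *)

theory Defs
  imports "HOL-Probability.Probability" "Jordan_Normal_Form.Matrix"
begin

hide_type (open) Finite_Cartesian_Product.vec
hide_const (open) Finite_Cartesian_Product.vec Finite_Cartesian_Product.mat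
no_notation Finite_Cartesian_Product.vec_nth (infixl \<open>$\<close> 90)

text \<open>
  The law of \<open>\<eta>\<^sup>\<mu>\<close>. As \<^const>\<open>bernoulli_pmf\<close> truncates its parameter to the unit interval, this
  is meaningful only for \<open>0 \<le> \<mu> \<le> 1\<close>; the point masses are computed below.
\<close>

definition eta_pmf :: "real \<Rightarrow> real pmf" where
  "eta_pmf \<mu> = bind_pmf (bernoulli_pmf \<mu>)
     (\<lambda>nonzero. if nonzero then pmf_of_set {1, - 1} else return_pmf 0)"

lemma pmf_eta_pmf:
  assumes "0 \<le> \<mu>" "\<mu> \<le> 1"
  shows "pmf (eta_pmf \<mu>) 0 = 1 - \<mu>" "pmf (eta_pmf \<mu>) 1 = \<mu> / 2" "pmf (eta_pmf \<mu>) (- 1) = \<mu> / 2"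
  using assms by (auto simp: eta_pmf_def pmf_bind)

text \<open>
  The law of \<open>M\<^sub>n\<^sup>\<mu>\<close>: the product distribution on the entries. The default value \<open>0\<close> outside of the
  index square plays no role, as \<^const>\<open>mat\<close> discards it.
\<close>

definition random_matrix_pmf :: "real \<Rightarrow> nat \<Rightarrow> real mat pmf" where
  "random_matrix_pmf \<mu> n =
     map_pmf (mat n n) (Pi_pmf ({..<n} \<times> {..<n}) 0 (\<lambda>_. eta_pmf \<mu>))"

definition euclidean_norm :: "real vec \<Rightarrow> real" where
  "euclidean_norm v = L2_set (\<lambda>i. v $ i) {..<dim_vec v}"

text \<open>
  The minimum over the unit sphere is written as an infimum; for \<open>n > 0\<close> it is attained, as shown
  below.
\<close>

definition smallest_singular_value :: "nat \<Rightarrow> real mat \<Rightarrow> real" where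
  "smallest_singular_value n M =
     (INF x \<in> {x \<in> carrier_vec n. euclidean_norm x = 1}. euclidean_norm (M *\<^sub>v x))"

lemma smallest_singular_value_attained:
  assumes M: "M \<in> carrier_mat n n" and n: "n > 0"
  shows "\<exists>x \<in> carrier_vec n. euclidean_norm x = 1 \<and>
           euclidean_norm (M *\<^sub>v x) = smallest_singular_value n M \<and>
           (\<forall>y \<in> carrier_vec n. euclidean_norm y = 1 \<longrightarrow>
              smallest_singular_value n M \<le> euclidean_norm (M *\<^sub>v y))"
proof -
  define S where "S = {x \<in> carrier_vec n. euclidean_norm x = 1}"
  define g where "g = (\<lambda>x. euclidean_norm (M *\<^sub>v x))"
  define K :: "(nat \<Rightarrow> real) set" where
    "K = PiE UNIV (\<lambda>i. if i < n then {-1..1} else {0}) \<inter> {f. L2_set f {..<n} = 1}"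
  define F where "F = (\<lambda>f :: nat \<Rightarrow> real. L2_set (\<lambda>i. \<Sum>j<n. M $$ (i, j) * f j) {..<n})"
  have F: "g (vec n f) = F f" for f
    using M by (auto simp: g_def F_def euclidean_norm_def scalar_prod_def atLeast0LessThan
        intro!: L2_set_cong sum.cong)
  have nrm: "euclidean_norm (vec n f) = L2_set f {..<n}" for f
    by (auto simp: euclidean_norm_def intro!: L2_set_cong)
  have coord: "continuous_on UNIV (\<lambda>f :: nat \<Rightarrow> real. f i)" for i
    by simp
  have cont1: "continuous_on UNIV (\<lambda>f :: nat \<Rightarrow> real. L2_set f {..<n})"
    unfolding L2_set_def by (intro continuous_intros coord)
  have cont2: "continuous_on UNIV F"
    unfolding F_def L2_set_def by (intro continuous_intros coord)
  have "compactin (product_topology (\<lambda>_. euclidean) UNIV)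
          (PiE UNIV (\<lambda>i :: nat. if i < n then {-1..1 :: real} else {0}))"
    unfolding compactin_PiE by auto
  hence "compact (PiE UNIV (\<lambda>i :: nat. if i < n then {-1..1 :: real} else {0}))"
    by (simp add: euclidean_product_topology)
  moreover have "closed {f :: nat \<Rightarrow> real. L2_set f {..<n} = 1}"
    by (intro closed_Collect_eq cont1 continuous_on_const)
  ultimately have K: "compact K"
    unfolding K_def by (rule compact_Int_closed)
  have KS: "vec n f \<in> S" if "f \<in> K" for f
    using that by (simp add: K_def S_def nrm)
  have SK: "\<exists>f \<in> K. x = vec n f" if "x \<in> S" for x
  proof -
    define f where "f = (\<lambda>i. if i < n then x $ i else 0)"
    have x: "x = vec n f"
      using that by (auto simp: S_def f_def)
    have L: "L2_set f {..<n} = 1"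
      using that x nrm[of f] by (simp add: S_def)
    have "\<bar>f i\<bar> \<le> 1" if "i < n" for i
      using member_le_L2_set[of "{..<n}" i "\<lambda>i. \<bar>f i\<bar>"] that L by (simp add: L2_set_def)
    hence "f \<in> K"
      using L by (auto simp: K_def f_def abs_le_iff split: if_splits)
    thus ?thesis using x by blast
  qed
  have "unit_vec n 0 \<in> S"
    using n nrm[of "\<lambda>j. if j = 0 then 1 else 0"]
    by (simp add: S_def unit_vec_def L2_set_def if_distrib[of "\<lambda>x. x\<^sup>2"] cong: if_cong)
  hence "K \<noteq> {}" using SK by blast
  then obtain f where f: "f \<in> K" "\<And>h. h \<in> K \<Longrightarrow> F f \<le> F h"
    using continuous_attains_inf[OF K _ continuous_on_subset[OF cont2]] by auto
  have le: "g (vec n f) \<le> g y" if "y \<in> S" for y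
    using SK[OF that] f(2) F by auto
  have "smallest_singular_value n M = Inf (g ` S)"
    by (simp add: smallest_singular_value_def g_def S_def)
  also have "\<dots> = g (vec n f)"
    using KS[OF f(1)] le by (intro cInf_eq_minimum) auto
  finally have "g (vec n f) = smallest_singular_value n M" ..
  thus ?thesis
    using KS[OF f(1)] le unfolding S_def g_def by (intro bexI[of _ "vec n f"]) auto
qed

end

theory Submission
  imports Defs "HOL-Real_Asymp.Real_Asymp" "Jordan_Normal_Form.Determinant"
begin

text \<open>
  Let \<open>C\<^sub>1, \<dots>, C\<^sub>n\<close> be the columns of the matrix. If \<open>M\<close> maps a unit vector to a vector of norm at
  most \<open>n powr - B\<close>, then some column \<open>C\<^sub>i\<close> almost lies in the span of the others, so that any vector
  \<open>x\<close> of maximum norm \<open>1\<close> orthogonal to the other columns satisfies \<open>\<bar>\<langle>C\<^sub>i, x\<rangle>\<bar> \<le> \<epsilon>\<close> with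
  \<open>\<epsilon> = n * n powr - B\<close>. The vector \<open>x\<close> can be chosen independently of \<open>C\<^sub>i\<close>. If \<open>x\<close> is poor, i.e. a
  random column \<open>X\<close> has \<open>\<bar>\<langle>X, x\<rangle>\<bar> \<le> \<epsilon>\<close> with probability less than \<open>n powr (- A - 1) / 2\<close>, this
  event is rare enough (\<open>prob_small_singular_value_le\<close>). It remains to show that a rich \<open>x\<close> is almost
  never orthogonal to \<open>n - 1\<close> independent columns (\<open>prob_rich_normal_le\<close>). This is a union bound over
  a finite set of vectors that approximate all rich \<open>x\<close>, which has to balance the number of
  approximants against the probability of near-orthogonality for each of them.

  If fewer than \<open>n powr (39/40)\<close> coordinates of \<open>x\<close> are at least \<open>n powr - 3\<close> in absolute value,
  then \<open>x\<close> is essentially a sparse vector. There are only \<open>exp (o(n))\<close> sparse integer vectors of polynomial size, and each is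
  nearly orthogonal to all columns with exponentially small probability.

  Otherwise \<open>x\<close> has, after rescaling to a vector \<open>v\<close>, at least \<open>n powr (39/40)\<close> coordinates, up to a
  constant factor, with absolute value between \<open>1\<close> and \<open>n powr (1/40)\<close>, and only few coordinates
  larger than that (\<open>exists_level_with_mass\<close>). By Fourier analysis (\<open>small_ball\<close>), the concentration
  of \<open>\<langle>X, v\<rangle>\<close> is controlled by the frequencies \<open>\<theta>\<close> for which \<open>\<theta> v\<close> is close to the integer
  lattice. Richness therefore yields a multiple \<open>\<theta> v\<close> very close to the lattice although \<open>\<theta>\<close> is not
  tiny, and \<open>\<theta>\<close> is chosen minimal. The closeness makes the number of roundings of \<open>\<theta> v\<close> about
  \<open>\<theta> powr n\<close>, up to factors that are small powers of \<open>n\<close> per coordinate. The minimality makes the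
  probability of near-orthogonality of a rounding with one column about \<open>n powr (- 1/4) / \<theta>\<close>, up to
  similar factors: the frequencies below \<open>\<theta>\<close> that lie close to the lattice form a single window of
  length about \<open>n powr (- 1/2)\<close>, and the rounding error contributes \<open>n powr (1/4)\<close>. The product
  over all columns is \<open>n powr (- c n)\<close> for a constant \<open>c > 0\<close>.

  The rounding error has to be less than what the triangle inequality gives for each
  column. Rounding the coordinates up or down one after another, such that each step
  increases the squared error at most by its own square, achieves the square-root cancellation of
  independent random signs (\<open>greedy_rounding\<close>). It bounds the error on the average over the columns,
  so that a few columns have to be given up.

  All small powers of \<open>n\<close> are integral powers of \<open>n powr (1/40)\<close>. The exponent \<open>B\<close> is
  \<open>\<lceil>A\<rceil> + 6\<close>.
\<close>

section \<open>The distance to the nearest integer\<close>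

definition idist :: "real \<Rightarrow> real" where
  "idist u = \<bar>u - of_int (round u)\<bar>"

lemma idist_nonneg: "0 \<le> idist u"
  by (simp add: idist_def)

lemma idist_le: "idist u \<le> \<bar>u - of_int k\<bar>"
  unfolding idist_def using round_diff_minimal[of u k] by (simp add: abs_minus_commute)

lemma idist_le_half: "idist u \<le> 1 / 2"
  unfolding idist_def using of_int_round_abs_le[of u] by (simp add: abs_minus_commute)

lemma idist_diff_le: "idist (u - v) \<le> idist u + idist v"
proof -
  have "idist (u - v) \<le> \<bar>(u - v) - of_int (round u - round v)\<bar>"
    by (rule idist_le)
  also have "\<dots> \<le> idist u + idist v"
    unfolding idist_def by simp
  finally show ?thesis .
qed

lemma idist_add_le: "idist (u + w) \<le> idist u + \<bar>w\<bar>"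
  using idist_le[of "u + w" "round u"] unfolding idist_def by linarith

lemma idist_small:
  assumes "\<bar>u\<bar> \<le> 1 / 2"
  shows "idist u = \<bar>u\<bar>"
proof (rule antisym)
  show "idist u \<le> \<bar>u\<bar>" using idist_le[of u 0] by simp
  show "\<bar>u\<bar> \<le> idist u"
  proof (cases "round u = 0")
    case False
    hence "1 \<le> \<bar>real_of_int (round u)\<bar>" by linarith
    thus ?thesis using assms unfolding idist_def by linarith
  qed (simp add: idist_def)
qed

lemma square_add_le: "((a::real) + b)\<^sup>2 \<le> 2 * a\<^sup>2 + 2 * b\<^sup>2"
  using zero_le_power2[of "a - b"] by (simp add: power2_eq_square algebra_simps)

lemma sin_ge_third:
  assumes "0 \<le> x" "x \<le> pi / 3"
  shows "x / 3 \<le> sin x"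
proof -
  have "(\<lambda>y. sin y - y / 3) 0 \<le> (\<lambda>y. sin y - y / 3) x"
  proof (rule DERIV_nonneg_imp_nondecreasing[OF assms(1)])
    fix y assume y: "0 \<le> y" "y \<le> x"
    have "cos (pi / 3) \<le> cos y"
      using y assms by (intro cos_monotone_0_pi_le) auto
    hence "0 \<le> cos y - 1 / 3" by (simp add: cos_60)
    moreover have "((\<lambda>y. sin y - y / 3) has_real_derivative cos y - 1 / 3) (at y)"
      by (auto intro!: derivative_eq_intros)
    ultimately show "\<exists>d. ((\<lambda>y. sin y - y / 3) has_real_derivative d) (at y) \<and> 0 \<le> d" by blast
  qed
  thus ?thesis by simp
qed

lemma abs_sin_pi_ge:
  assumes "\<bar>t\<bar> \<le> 1 / 2"
  shows "\<bar>t\<bar> \<le> \<bar>sin (pi * t)\<bar>"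
proof -
  have *: "t \<le> sin (pi * t)" if t: "0 \<le> t" "t \<le> 1 / 2" for t
  proof (cases "t \<le> 1 / 3")
    case True
    have "3 * t \<le> pi * t" using t(1) pi_gt3 by (intro mult_right_mono) auto
    moreover have "pi * t / 3 \<le> sin (pi * t)"
      using t(1) True by (intro sin_ge_third) (auto simp: field_simps)
    ultimately show ?thesis by linarith
  next
    case False
    have "sin (pi / 3) \<le> sin (pi * t)"
      using t False by (intro sin_monotone_2pi_le) (auto simp: field_simps)
    moreover have "(1::real) \<le> sqrt 3" by simp
    ultimately show ?thesis using t by (simp only: sin_60)
  qed
  show ?thesis
  proof (cases "0 \<le> t")
    case True
    thus ?thesis using *[of t] assms by linarith
  next
    case False
    thus ?thesis using *[of "- t"] assms by simp
  qed
qed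

text \<open>
  This turns decay of a characteristic function, which is governed by a sine, into decay in the
  distance to the integers.
\<close>

lemma sin_squared_ge_idist: "(idist u)\<^sup>2 \<le> (sin (pi * u))\<^sup>2"
proof -
  define t where "t = u - of_int (round u)"
  have "pi * u = pi * t + of_int (round u) * pi"
    by (simp add: t_def algebra_simps)
  moreover have sin0: "sin (of_int (round u) * pi) = 0"
    by (subst sin_times_pi_eq_0) simp
  ultimately have "(sin (pi * u))\<^sup>2 = (sin (pi * t) * cos (of_int (round u) * pi))\<^sup>2"
    by (simp only: sin_add) simp
  moreover have "(cos (of_int (round u) * pi))\<^sup>2 = 1"
    by (simp add: cos_squared_eq sin0)
  ultimately have "(sin (pi * u))\<^sup>2 = (sin (pi * t))\<^sup>2"
    by (simp add: power_mult_distrib)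
  moreover have "\<bar>t\<bar> \<le> \<bar>sin (pi * t)\<bar>"
    using idist_le_half[of u] by (intro abs_sin_pi_ge) (simp add: t_def idist_def)
  ultimately show ?thesis
    by (simp add: idist_def t_def[symmetric] abs_le_square_iff)
qed

section \<open>Concentration of random signed sums\<close>

lemma set_pmf_eta: "set_pmf (eta_pmf \<mu>) \<subseteq> {0, 1, - 1}"
  by (auto simp: eta_pmf_def split: if_splits)

lemma finite_set_pmf_eta: "finite (set_pmf (eta_pmf \<mu>))"
  using set_pmf_eta by (rule finite_subset) simp

lemma finite_set_pmf_Pi:
  assumes "finite I" "\<And>i. i \<in> I \<Longrightarrow> finite (set_pmf (p i))"
  shows "finite (set_pmf (Pi_pmf I d p))"
  using assms by (subst set_Pi_pmf) (auto intro!: finite_PiE_dflt)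

lemma expectation_eta:
  assumes "0 \<le> \<mu>" "\<mu> \<le> 1"
  shows "measure_pmf.expectation (eta_pmf \<mu>) g = (1 - \<mu>) * g 0 + \<mu> / 2 * g 1 + \<mu> / 2 * (g (- 1) :: real)"
proof -
  have "measure_pmf.expectation (eta_pmf \<mu>) g = (\<Sum>a\<in>{0, 1, - 1}. g a * pmf (eta_pmf \<mu>) a)"
    using set_pmf_eta by (intro integral_measure_pmf_real) auto
  thus ?thesis by (simp add: pmf_eta_pmf[OF assms] algebra_simps)
qed

text \<open>
  The law of \<open>\<eta>\<close> is symmetric, so the characteristic function of a sum is real and no complex numbers
  are needed. The phase \<open>a\<close> is what makes the induction work: it absorbs the terms already summed.
\<close>

lemma expectation_cos_linear_form:
  assumes \<mu>: "0 \<le> \<mu>" "\<mu> \<le> 1" and I: "finite I"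
  shows "measure_pmf.expectation (Pi_pmf I 0 (\<lambda>_. eta_pmf \<mu>)) (\<lambda>X. cos (a + (\<Sum>i\<in>I. X i * v i)))
           = cos a * (\<Prod>i\<in>I. 1 - \<mu> + \<mu> * cos (v i))"
  using I
proof (induction I arbitrary: a rule: finite_induct)
  case (insert x I)
  let ?P = "Pi_pmf I 0 (\<lambda>_. eta_pmf \<mu>)"
  let ?c = "\<Prod>i\<in>I. 1 - \<mu> + \<mu> * cos (v i)"
  have fin: "finite (set_pmf ?P)"
    using insert.hyps finite_set_pmf_eta by (intro finite_set_pmf_Pi)
  have eq: "Pi_pmf (insert x I) 0 (\<lambda>_. eta_pmf \<mu>)
      = bind_pmf (eta_pmf \<mu>) (\<lambda>y. map_pmf (\<lambda>f. f(x := y)) ?P)"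
    using insert.hyps by (simp add: Pi_pmf_insert' map_pmf_def)
  have inner: "measure_pmf.expectation (map_pmf (\<lambda>f. f(x := y)) ?P)
      (\<lambda>X. cos (a + (\<Sum>i\<in>insert x I. X i * v i))) = cos (a + y * v x) * ?c" for y
  proof -
    have "(\<Sum>i\<in>insert x I. (f(x := y)) i * v i) = y * v x + (\<Sum>i\<in>I. f i * v i)" for f :: "'a \<Rightarrow> real"
      using insert.hyps by (simp, intro sum.cong) auto
    thus ?thesis using insert.IH[of "a + y * v x"] by (simp add: add.assoc)
  qed
  have "measure_pmf.expectation (Pi_pmf (insert x I) 0 (\<lambda>_. eta_pmf \<mu>))
      (\<lambda>X. cos (a + (\<Sum>i\<in>insert x I. X i * v i)))
      = (\<Sum>y\<in>{0, 1, - 1}. pmf (eta_pmf \<mu>) y *\<^sub>R (cos (a + y * v x) * ?c))"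
    unfolding eq using fin set_pmf_eta
    by (subst pmf_expectation_bind[where A = "{0, 1, - 1}"])
      (auto simp: inner simp del: integral_map_pmf sum.insert)
  also have "\<dots> = (1 - \<mu> + \<mu> * cos (v x)) * (cos a * ?c)"
    by (simp add: pmf_eta_pmf[OF \<mu>] cos_add cos_diff algebra_simps)
  finally show ?case using insert.hyps by (simp add: algebra_simps)
qed simp

text \<open>
  The square of the characteristic function is at most \<open>1 - \<mu>\<^sup>2 sin\<^sup>2\<close>. Passing to the square is
  needed for large \<open>\<mu>\<close>: for \<open>\<mu> = 1\<close> the function is a cosine, whose absolute value is \<open>1\<close> at all
  multiples of \<open>\<pi>\<close>, which is why frequencies are measured in units of \<open>\<pi>\<close> and not of \<open>2 \<pi>\<close>.
\<close>

lemma char_eta_le: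
  assumes "0 \<le> \<mu>" "\<mu> \<le> 1"
  shows "\<bar>1 - \<mu> + \<mu> * cos (pi * u)\<bar> \<le> exp (- (\<mu>\<^sup>2 / 2) * (idist u)\<^sup>2)"
proof -
  let ?c = "cos (pi * u)"
  have "(1 - \<mu> + \<mu> * ?c)\<^sup>2 = (1 - \<mu>\<^sup>2) - 2 * (\<mu> * (1 - \<mu>)) * (1 - ?c) + \<mu>\<^sup>2 * ?c\<^sup>2"
    by (simp add: power2_eq_square algebra_simps)
  also have "\<dots> \<le> 1 - \<mu>\<^sup>2 + \<mu>\<^sup>2 * ?c\<^sup>2"
    using assms by simp
  also have "\<dots> = 1 - \<mu>\<^sup>2 * (sin (pi * u))\<^sup>2"
    by (simp add: sin_squared_eq algebra_simps)
  also have "\<dots> \<le> 1 - \<mu>\<^sup>2 * (idist u)\<^sup>2"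
    using sin_squared_ge_idist by (simp add: mult_left_mono)
  also have "\<dots> \<le> exp (- (\<mu>\<^sup>2 * (idist u)\<^sup>2))"
    using exp_ge_add_one_self[of "- (\<mu>\<^sup>2 * (idist u)\<^sup>2)"] by simp
  also have "\<dots> = (exp (- (\<mu>\<^sup>2 / 2) * (idist u)\<^sup>2))\<^sup>2"
    by (simp add: power2_eq_square flip: exp_add)
  finally show ?thesis
    by (simp add: abs_le_square_iff[symmetric])
qed

lemma char_eta_abs_le_1:
  fixes u :: real
  assumes "0 \<le> \<mu>" "\<mu> \<le> 1"
  shows "\<bar>1 - \<mu> + \<mu> * cos u\<bar> \<le> 1"
proof -
  have "\<mu> * cos u \<le> \<mu> * 1" "\<mu> * (- 1) \<le> \<mu> * cos u"
    using assms cos_le_one[of u] cos_ge_minus_one[of u] by (blast intro: mult_left_mono)+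
  thus ?thesis using assms by (simp add: abs_le_iff)
qed

lemma sum_cos_differences:
  "(\<Sum>k<N. \<Sum>l<N. cos ((real k - real l) * z)) = (\<Sum>k<N. cos (real k * z))\<^sup>2 + (\<Sum>k<N. sin (real k * z))\<^sup>2"
  by (simp add: power2_eq_square sum_product sum.distrib[symmetric] cos_diff left_diff_distrib)

text \<open>
  A discrete Fejer kernel: the double sum is a sum of two squares, hence nonnegative everywhere, and
  it is of order \<open>N\<^sup>2\<close> near zero because there every summand of the cosine sum is at least \<open>1/2\<close>.
  It thus majorises the indicator of an interval by finitely many cosines.
\<close>

lemma fejer_lower_bound:
  assumes "\<bar>z\<bar> * real N \<le> pi / 3"
  shows "(real N)\<^sup>2 / 4 \<le> (\<Sum>k<N. \<Sum>l<N. cos ((real k - real l) * z))"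
proof -
  have "1 / 2 \<le> cos (real k * z)" if "k < N" for k
  proof -
    have "real k * \<bar>z\<bar> \<le> real N * \<bar>z\<bar>" using that by (intro mult_right_mono) auto
    hence "real k * \<bar>z\<bar> \<le> pi / 3" using assms by (simp add: mult.commute)
    hence "cos (pi / 3) \<le> cos (\<bar>real k * z\<bar>)"
      by (intro cos_monotone_0_pi_le) (auto simp: abs_mult)
    thus ?thesis by (simp add: cos_60)
  qed
  hence "(\<Sum>k<N. 1 / 2) \<le> (\<Sum>k<N. cos (real k * z))"
    by (intro sum_mono) auto
  hence "(real N / 2)\<^sup>2 \<le> (\<Sum>k<N. cos (real k * z))\<^sup>2"
    by (intro power_mono) auto
  thus ?thesis by (simp add: sum_cos_differences power_divide add_increasing2)
qed

text \<open>
  For fixed \<open>k\<close>, every difference occurs at most twice.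
\<close>

lemma sum_sum_abs_diff_le:
  fixes a :: "nat \<Rightarrow> real"
  assumes "\<And>j. 0 \<le> a j"
  shows "(\<Sum>k<N. \<Sum>l<N. a (nat \<bar>int k - int l\<bar>)) \<le> 2 * real N * (\<Sum>j<N. a j)"
proof -
  have "(\<Sum>l<N. a (nat \<bar>int k - int l\<bar>)) \<le> 2 * (\<Sum>j<N. a j)" if k: "k < N" for k
  proof -
    have "(\<Sum>l<N. a (nat \<bar>int k - int l\<bar>)) \<le> (\<Sum>l\<le>k. a (k - l)) + (\<Sum>l\<in>{k..<N}. a (l - k))"
    proof -
      have "(\<Sum>l<N. a (nat \<bar>int k - int l\<bar>)) \<le> (\<Sum>l\<in>{..k} \<union> {k..<N}. a (nat \<bar>int k - int l\<bar>))"
        using assms by (intro sum_mono2) auto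
      also have "\<dots> \<le> (\<Sum>l\<le>k. a (nat \<bar>int k - int l\<bar>)) + (\<Sum>l\<in>{k..<N}. a (nat \<bar>int k - int l\<bar>))"
        using assms by (subst sum_Un) (auto intro!: sum_nonneg)
      also have "(\<Sum>l\<le>k. a (nat \<bar>int k - int l\<bar>)) = (\<Sum>l\<le>k. a (k - l))"
        by (intro sum.cong refl arg_cong[of _ _ a]) auto
      also have "(\<Sum>l\<in>{k..<N}. a (nat \<bar>int k - int l\<bar>)) = (\<Sum>l\<in>{k..<N}. a (l - k))"
        by (intro sum.cong refl arg_cong[of _ _ a]) auto
      finally show ?thesis .
    qed
    also have "(\<Sum>l\<le>k. a (k - l)) = (\<Sum>j\<le>k. a j)"
      by (rule sum.reindex_bij_witness[of _ "\<lambda>j. k - j" "\<lambda>j. k - j"]) auto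
    also have "\<dots> \<le> (\<Sum>j<N. a j)"
      using k assms by (intro sum_mono2) auto
    also have "(\<Sum>l\<in>{k..<N}. a (l - k)) = (\<Sum>j<N - k. a j)"
      by (rule sum.reindex_bij_witness[of _ "\<lambda>j. j + k" "\<lambda>j. j - k"]) auto
    also have "\<dots> \<le> (\<Sum>j<N. a j)"
      using assms by (intro sum_mono2) auto
    finally show ?thesis by simp
  qed
  hence "(\<Sum>k<N. \<Sum>l<N. a (nat \<bar>int k - int l\<bar>)) \<le> (\<Sum>k<N. 2 * (\<Sum>j<N. a j))"
    by (intro sum_mono) auto
  thus ?thesis by simp
qed

text \<open>
  An inequality of Esseen type. The indicator of the event is majorised by the Fejer kernel, the
  expectation of which is a mean of products of characteristic functions. The factors outside of \<open>J\<close>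
  are bounded by \<open>1\<close>: discarding coordinates amounts to conditioning on the corresponding entries.
\<close>

lemma small_ball:
  fixes v :: "'i \<Rightarrow> real"
  assumes \<mu>: "0 \<le> \<mu>" "\<mu> \<le> 1" and I: "finite I" and J: "J \<subseteq> I" and N: "N > 0" and \<eta>: "\<eta> > 0"
  shows "measure_pmf.prob (Pi_pmf I 0 (\<lambda>_. eta_pmf \<mu>)) {X. \<bar>\<Sum>i\<in>I. X i * v i\<bar> \<le> 1 / (3 * \<eta> * real N)}
           \<le> 8 / real N * (\<Sum>j<N. exp (- (\<mu>\<^sup>2 / 2) * (\<Sum>i\<in>J. (idist (\<eta> * real j * v i))\<^sup>2)))"
proof -
  let ?P = "Pi_pmf I 0 (\<lambda>_. eta_pmf \<mu>)"
  let ?S = "\<lambda>X. \<Sum>i\<in>I. X i * v i"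
  let ?E = "{X. \<bar>?S X\<bar> \<le> 1 / (3 * \<eta> * real N)}"
  let ?a = "\<lambda>j::nat. exp (- (\<mu>\<^sup>2 / 2) * (\<Sum>i\<in>J. (idist (\<eta> * real j * v i))\<^sup>2))"
  have fin: "finite (set_pmf ?P)"
    using I finite_set_pmf_eta by (intro finite_set_pmf_Pi)
  have intg: "integrable (measure_pmf ?P) g" for g :: "_ \<Rightarrow> real"
    by (rule integrable_measure_pmf_finite[OF fin])
  have point: "indicator ?E X \<le> 4 / (real N)\<^sup>2 * (\<Sum>k<N. \<Sum>l<N. cos ((real k - real l) * (pi * \<eta> * ?S X)))" for X
  proof (cases "X \<in> ?E")
    case True
    hence "\<bar>?S X\<bar> * (3 * \<eta> * real N) \<le> 1"
      using N \<eta> by (simp add: field_simps)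
    hence "pi / 3 * (\<bar>?S X\<bar> * (3 * \<eta> * real N)) \<le> pi / 3 * 1"
      by (intro mult_left_mono) auto
    hence "\<bar>pi * \<eta> * ?S X\<bar> * real N \<le> pi / 3"
      using \<eta> by (simp add: abs_mult algebra_simps)
    from fejer_lower_bound[OF this] show ?thesis
      using True N by (simp add: field_simps)
  next
    case False
    thus ?thesis by (simp add: sum_cos_differences)
  qed
  have char: "measure_pmf.expectation ?P (\<lambda>X. cos ((real k - real l) * (pi * \<eta> * ?S X)))
      \<le> ?a (nat \<bar>int k - int l\<bar>)" for k l
  proof -
    define j where "j = nat \<bar>int k - int l\<bar>"
    have j: "real j = \<bar>real k - real l\<bar>"
      by (simp add: j_def)
    have "cos ((real k - real l) * (pi * \<eta> * ?S X)) = cos (0 + (\<Sum>i\<in>I. X i * (pi * (\<eta> * real j * v i))))" for X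
    proof -
      have "(\<Sum>i\<in>I. X i * (pi * (\<eta> * real j * v i))) = real j * (pi * \<eta> * ?S X)"
        by (simp add: sum_distrib_left sum_distrib_right algebra_simps)
      moreover have "cos (real j * (pi * \<eta> * ?S X)) = cos ((real k - real l) * (pi * \<eta> * ?S X))"
        unfolding j by (cases "real k \<ge> real l")
          (simp_all add: abs_if, metis cos_minus minus_diff_eq mult_minus_left)
      ultimately show ?thesis by simp
    qed
    hence "measure_pmf.expectation ?P (\<lambda>X. cos ((real k - real l) * (pi * \<eta> * ?S X)))
        = measure_pmf.expectation ?P (\<lambda>X. cos (0 + (\<Sum>i\<in>I. X i * (pi * (\<eta> * real j * v i)))))"
      by presburger
    also have "\<dots> = (\<Prod>i\<in>I. 1 - \<mu> + \<mu> * cos (pi * (\<eta> * real j * v i)))"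
      by (subst expectation_cos_linear_form[OF \<mu> I]) simp
    also have "\<dots> \<le> (\<Prod>i\<in>I. \<bar>1 - \<mu> + \<mu> * cos (pi * (\<eta> * real j * v i))\<bar>)"
      by (simp flip: abs_prod)
    also have "\<dots> \<le> (\<Prod>i\<in>I. if i \<in> J then exp (- (\<mu>\<^sup>2 / 2) * (idist (\<eta> * real j * v i))\<^sup>2) else 1)"
      using char_eta_le[OF \<mu>] char_eta_abs_le_1[OF \<mu>] by (intro prod_mono) auto
    also have "\<dots> = (\<Prod>i\<in>J. exp (- (\<mu>\<^sup>2 / 2) * (idist (\<eta> * real j * v i))\<^sup>2))"
      using J I by (subst prod.inter_restrict[symmetric]) (auto simp: Int_absorb1)
    also have "\<dots> = ?a j"
      using finite_subset[OF J I] by (simp add: exp_sum sum_distrib_left)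
    finally show ?thesis by (simp add: j_def)
  qed
  have "measure_pmf.prob ?P ?E = measure_pmf.expectation ?P (indicator ?E)"
    by simp
  also have "\<dots> \<le> measure_pmf.expectation ?P
      (\<lambda>X. 4 / (real N)\<^sup>2 * (\<Sum>k<N. \<Sum>l<N. cos ((real k - real l) * (pi * \<eta> * ?S X))))"
    by (intro integral_mono intg point)
  also have "\<dots> = 4 / (real N)\<^sup>2 * (\<Sum>k<N. \<Sum>l<N. measure_pmf.expectation ?P
      (\<lambda>X. cos ((real k - real l) * (pi * \<eta> * ?S X))))"
    by (simp add: Bochner_Integration.integral_sum intg)
  also have "\<dots> \<le> 4 / (real N)\<^sup>2 * (\<Sum>k<N. \<Sum>l<N. ?a (nat \<bar>int k - int l\<bar>))"
    by (intro mult_left_mono sum_mono char) auto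
  also have "\<dots> \<le> 4 / (real N)\<^sup>2 * (2 * real N * (\<Sum>j<N. ?a j))"
    by (intro mult_left_mono sum_sum_abs_diff_le) auto
  also have "\<dots> = 8 / real N * (\<Sum>j<N. ?a j)"
    using N by (simp add: power2_eq_square)
  finally show ?thesis .
qed

section \<open>Independent columns\<close>

lemma prob_bind_pmf_le:
  assumes "\<And>a. a \<in> set_pmf p \<Longrightarrow> measure_pmf.prob (f a) E \<le> \<kappa>" "0 \<le> \<kappa>"
  shows "measure_pmf.prob (bind_pmf p f) E \<le> \<kappa>"
proof -
  have "emeasure (measure_pmf (bind_pmf p f)) E = (\<integral>\<^sup>+a. emeasure (measure_pmf (f a)) E \<partial>measure_pmf p)"
    by simp
  also have "\<dots> \<le> (\<integral>\<^sup>+a. ennreal \<kappa> \<partial>measure_pmf p)"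
    using assms by (intro nn_integral_mono_AE)
      (auto simp: AE_measure_pmf_iff measure_pmf.emeasure_eq_measure intro!: ennreal_leI)
  also have "\<dots> = ennreal \<kappa>" by simp
  finally show ?thesis
    using assms(2) by (simp add: measure_pmf.emeasure_eq_measure)
qed

text \<open>
  Fubini, with the coordinate \<open>x\<close> integrated first.
\<close>

lemma prob_Pi_pmf_condition:
  assumes "finite A" "x \<in> A" "0 \<le> \<kappa>"
    and "\<And>f. f \<in> set_pmf (Pi_pmf (A - {x}) d p) \<Longrightarrow> measure_pmf.prob (p x) {y. f(x := y) \<in> E} \<le> \<kappa>"
  shows "measure_pmf.prob (Pi_pmf A d p) E \<le> \<kappa>"
proof -
  have "Pi_pmf A d p = Pi_pmf (insert x (A - {x})) d p"
    using assms(2) by (simp add: insert_absorb)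
  also have "\<dots> = bind_pmf (Pi_pmf (A - {x}) d p) (\<lambda>f. map_pmf (\<lambda>y. f(x := y)) (p x))"
    using assms(1) by (subst Pi_pmf_insert') (auto simp: map_pmf_def intro: bind_commute_pmf)
  finally have eq: "Pi_pmf A d p = bind_pmf (Pi_pmf (A - {x}) d p) (\<lambda>f. map_pmf (\<lambda>y. f(x := y)) (p x))" .
  show ?thesis unfolding eq
    using assms(3,4) by (intro prob_bind_pmf_le) (auto simp: vimage_def)
qed

text \<open>
  Given the other entries, at most one of the three values \<open>0\<close>, \<open>1\<close>, \<open>- 1\<close> of the \<open>i\<close>-th entry puts
  the sum into the interval, and none of these values has probability more than \<open>1 - \<mu> / 2\<close>.
\<close>

lemma prob_linear_form_large_coefficient:
  fixes w :: "'i \<Rightarrow> real"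
  assumes \<mu>: "0 \<le> \<mu>" "\<mu> \<le> 1" and I: "finite I" "i \<in> I" and w: "2 * t < \<bar>w i\<bar>"
  shows "measure_pmf.prob (Pi_pmf I 0 (\<lambda>_. eta_pmf \<mu>)) {X. \<bar>\<Sum>i\<in>I. X i * w i\<bar> \<le> t} \<le> 1 - \<mu> / 2"
proof (rule prob_Pi_pmf_condition[OF I])
  show "0 \<le> 1 - \<mu> / 2" using \<mu> by simp
  fix f :: "'i \<Rightarrow> real"
  define S where "S = (\<Sum>i\<in>I - {i}. f i * w i)"
  define E where "E = {y. \<bar>y * w i + S\<bar> \<le> t}"
  have E: "{y. f(i := y) \<in> {X. \<bar>\<Sum>i\<in>I. X i * w i\<bar> \<le> t}} = E"
  proof -
    have "(\<Sum>k\<in>I. (f(i := y)) k * w k) = y * w i + S" for y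
      unfolding S_def using I by (subst sum.remove[of _ i]) (auto intro!: sum.cong)
    thus ?thesis by (simp add: E_def)
  qed
  have "measure_pmf.prob (eta_pmf \<mu>) E = measure_pmf.expectation (eta_pmf \<mu>) (indicator E)"
    by simp
  also have "\<dots> = (1 - \<mu>) * indicator E 0 + \<mu> / 2 * indicator E 1 + \<mu> / 2 * indicator E (- 1)"
    by (rule expectation_eta[OF \<mu>])
  also have "\<dots> \<le> 1 - \<mu> / 2"
  proof -
    have "\<not> (0 \<in> E \<and> 1 \<in> E)" "\<not> (0 \<in> E \<and> - 1 \<in> E)" "\<not> (1 \<in> E \<and> - 1 \<in> E)"
      using w by (auto simp: E_def)
    thus ?thesis using \<mu> by (auto simp: indicator_def)
  qed
  finally show "measure_pmf.prob (eta_pmf \<mu>) {y. f(i := y) \<in> {X. \<bar>\<Sum>i\<in>I. X i * w i\<bar> \<le> t}} \<le> 1 - \<mu> / 2"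
    unfolding E .
qed

lemma prob_columns_in:
  assumes "finite A" "S \<subseteq> A"
  shows "measure_pmf.prob (Pi_pmf A d (\<lambda>_. p)) {F. \<forall>j\<in>S. F j \<in> E} = measure_pmf.prob p E ^ card S"
proof -
  have "{F. \<forall>j\<in>S. F j \<in> E} = Pi A (\<lambda>j. if j \<in> S then E else UNIV)"
    using assms(2) by (auto simp: Pi_def split: if_splits)
  hence "measure_pmf.prob (Pi_pmf A d (\<lambda>_. p)) {F. \<forall>j\<in>S. F j \<in> E}
      = (\<Prod>j\<in>A. measure_pmf.prob p (if j \<in> S then E else UNIV))"
    by (simp add: measure_Pi_pmf_Pi[OF assms(1)])
  also have "\<dots> = (\<Prod>j\<in>A. if j \<in> S then measure_pmf.prob p E else 1)"
    by (intro prod.cong) auto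
  also have "\<dots> = measure_pmf.prob p E ^ card S"
    using assms by (subst prod.inter_restrict[symmetric]) (auto simp: Int_absorb1)
  finally show ?thesis .
qed

text \<open>
  A union bound over the set of columns that lie in \<open>E\<close>, which costs the factor \<open>2 ^ card A\<close>.
\<close>

lemma prob_many_columns_in:
  assumes A: "finite A" and q: "measure_pmf.prob p E \<le> q" "q \<le> 1"
  shows "measure_pmf.prob (Pi_pmf A d (\<lambda>_. p)) {F. m \<le> card {j \<in> A. F j \<in> E}} \<le> 2 ^ card A * q ^ m"
proof -
  let ?P = "measure_pmf.prob (Pi_pmf A d (\<lambda>_. p))"
  have q0: "0 \<le> q" using q(1) measure_nonneg[of "measure_pmf p" E] by linarith
  have "?P {F. m \<le> card {j \<in> A. F j \<in> E}} \<le> ?P (\<Union>S\<in>{S \<in> Pow A. m \<le> card S}. {F. \<forall>j\<in>S. F j \<in> E})"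
  proof (intro measure_pmf.finite_measure_mono subsetI)
    fix F :: "'a \<Rightarrow> 'b" assume "F \<in> {F. m \<le> card {j \<in> A. F j \<in> E}}"
    thus "F \<in> (\<Union>S\<in>{S \<in> Pow A. m \<le> card S}. {F. \<forall>j\<in>S. F j \<in> E})"
      by (intro UN_I[of "{j \<in> A. F j \<in> E}"]) auto
  qed auto
  also have "\<dots> \<le> (\<Sum>S\<in>{S \<in> Pow A. m \<le> card S}. ?P {F. \<forall>j\<in>S. F j \<in> E})"
    using A by (intro measure_pmf.finite_measure_subadditive_finite) auto
  also have "\<dots> \<le> (\<Sum>S\<in>{S \<in> Pow A. m \<le> card S}. q ^ m)"
  proof (intro sum_mono)
    fix S assume S: "S \<in> {S \<in> Pow A. m \<le> card S}"
    have "?P {F. \<forall>j\<in>S. F j \<in> E} = measure_pmf.prob p E ^ card S"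
      using S A by (intro prob_columns_in) auto
    also have "\<dots> \<le> q ^ card S" using q by (intro power_mono) auto
    also have "\<dots> \<le> q ^ m" using S q q0 by (intro power_decreasing) auto
    finally show "?P {F. \<forall>j\<in>S. F j \<in> E} \<le> q ^ m" .
  qed
  also have "\<dots> = real (card {S \<in> Pow A. m \<le> card S}) * q ^ m" by simp
  also have "\<dots> \<le> real (card (Pow A)) * q ^ m"
    using A q0 by (intro mult_right_mono of_nat_mono card_mono) auto
  also have "\<dots> = 2 ^ card A * q ^ m" using A by (simp add: card_Pow)
  finally show ?thesis .
qed

definition column_pmf :: "real \<Rightarrow> nat \<Rightarrow> (nat \<Rightarrow> real) pmf" where
  "column_pmf \<mu> n = Pi_pmf {..<n} 0 (\<lambda>_. eta_pmf \<mu>)"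

lemma Pi_pmf_Times:
  assumes [simp]: "finite I" "finite J"
  shows "Pi_pmf (I \<times> J) d (\<lambda>_. p)
           = map_pmf (\<lambda>F (r, j). F j r) (Pi_pmf J (\<lambda>_. d) (\<lambda>_. Pi_pmf I d (\<lambda>_. p)))"
proof (rule pmf_eqI)
  fix g :: "'a \<times> 'b \<Rightarrow> 'c"
  let ?h = "\<lambda>F (r, j). F j r"
  let ?Q = "Pi_pmf J (\<lambda>_. d) (\<lambda>_. Pi_pmf I d (\<lambda>_. p))"
  define k where "k = (\<lambda>j r. g (r, j))"
  have "inj (?h :: ('b \<Rightarrow> 'a \<Rightarrow> 'c) \<Rightarrow> _)"
    by (auto simp: inj_def fun_eq_iff)
  moreover have hk: "?h k = g" by (auto simp: k_def)
  ultimately have "pmf (map_pmf ?h ?Q) g = pmf ?Q k"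
    by (metis pmf_map_inj')
  also have "\<dots> = (if \<forall>x. x \<notin> I \<times> J \<longrightarrow> g x = d then \<Prod>x\<in>I \<times> J. pmf p (g x) else 0)"
  proof (cases "\<forall>x. x \<notin> I \<times> J \<longrightarrow> g x = d")
    case True
    hence "pmf ?Q k = (\<Prod>j\<in>J. \<Prod>r\<in>I. pmf p (g (r, j)))"
      by (subst pmf_Pi') (auto simp: k_def fun_eq_iff pmf_Pi intro!: prod.cong)
    also have "\<dots> = (\<Prod>x\<in>I \<times> J. pmf p (g x))"
      by (subst prod.swap) (simp add: prod.cartesian_product)
    finally show ?thesis using True by simp
  next
    case False
    then obtain r j where rj: "(r, j) \<notin> I \<times> J" "g (r, j) \<noteq> d" by auto
    show ?thesis
    proof (cases "j \<in> J")
      case True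
      hence "pmf (Pi_pmf I d (\<lambda>_. p)) (k j) = 0"
        using rj by (intro pmf_Pi_outside) (auto simp: k_def)
      hence "(\<Prod>j\<in>J. pmf (Pi_pmf I d (\<lambda>_. p)) (k j)) = 0"
        using True by (intro prod_zero) auto
      hence "pmf ?Q k = 0" by (simp add: pmf_Pi)
      thus ?thesis using False by auto
    next
      case j: False
      hence "pmf ?Q k = 0"
        using rj by (intro pmf_Pi_outside) (auto simp: k_def fun_eq_iff)
      thus ?thesis using False by auto
    qed
  qed
  also have "\<dots> = pmf (Pi_pmf (I \<times> J) d (\<lambda>_. p)) g"
    by (simp add: pmf_Pi)
  finally show "pmf (Pi_pmf (I \<times> J) d (\<lambda>_. p)) g = pmf (map_pmf ?h ?Q) g" by simp
qed

lemma random_matrix_pmf_columns: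
  "random_matrix_pmf \<mu> n = map_pmf (\<lambda>F. mat n n (\<lambda>(r, j). F j r))
     (Pi_pmf {..<n} (\<lambda>_. 0) (\<lambda>_. column_pmf \<mu> n))"
  unfolding random_matrix_pmf_def column_pmf_def
  by (subst Pi_pmf_Times) (auto simp: pmf.map_comp o_def)

lemma abs_entry_le_1:
  assumes "F \<in> set_pmf (Pi_pmf A (\<lambda>_. 0) (\<lambda>_. column_pmf \<mu> n))" "finite A"
  shows "\<bar>F j r\<bar> \<le> 1"
proof (cases "j \<in> A \<and> r < n")
  case True
  hence "F j \<in> set_pmf (column_pmf \<mu> n)"
    using assms by (auto simp: set_Pi_pmf PiE_dflt_def)
  hence "F j r \<in> set_pmf (eta_pmf \<mu>)"
    using True by (auto simp: column_pmf_def set_Pi_pmf PiE_dflt_def)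
  thus ?thesis using set_pmf_eta[of \<mu>] by auto
next
  case False
  hence "F j r = 0"
    using assms set_Pi_pmf_subset[of "{..<n}" 0 "\<lambda>_. eta_pmf \<mu>"]
    by (cases "j \<in> A") (auto simp: set_Pi_pmf PiE_dflt_def column_pmf_def)
  thus ?thesis by simp
qed

section \<open>A small singular value forces a nearly dependent column\<close>

text \<open>
  The square matrix whose rows are the given columns, with the \<open>i\<close>-th one replaced by zero, is
  singular.
\<close>

lemma exists_orthogonal_vector:
  fixes F :: "nat \<Rightarrow> nat \<Rightarrow> real"
  assumes i: "i < n"
  shows "\<exists>x. (\<forall>r<n. \<bar>x r\<bar> \<le> 1) \<and> (\<exists>r<n. \<bar>x r\<bar> = 1) \<and>
             (\<forall>j<n. j \<noteq> i \<longrightarrow> (\<Sum>r<n. F j r * x r) = 0)"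
proof -
  define A where "A = mat n n (\<lambda>(j, r). if j = i then 0 else F j r)"
  have A: "A \<in> carrier_mat n n" by (simp add: A_def)
  have "A\<^sup>T *\<^sub>v unit_vec n i = 0\<^sub>v n"
    using i by (intro eq_vecI) (auto simp: A_def)
  moreover have "unit_vec n i \<noteq> (0\<^sub>v n :: real vec)"
    using i by (metis index_unit_vec(1) index_zero_vec(1) zero_neq_one)
  ultimately have "det (A\<^sup>T) = 0"
    using A i by (subst det_0_iff_vec_prod_zero) (auto intro!: exI[of _ "unit_vec n i"])
  hence "det A = 0" using A by (simp add: det_transpose)
  then obtain v where v: "v \<in> carrier_vec n" "v \<noteq> 0\<^sub>v n" "A *\<^sub>v v = 0\<^sub>v n"
    using A by (subst (asm) det_0_iff_vec_prod_zero) auto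
  define m where "m = Max ((\<lambda>r. \<bar>v $ r\<bar>) ` {..<n})"
  have fin: "finite ((\<lambda>r. \<bar>v $ r\<bar>) ` {..<n})" "(\<lambda>r. \<bar>v $ r\<bar>) ` {..<n} \<noteq> {}"
    using i by auto
  have le: "\<bar>v $ r\<bar> \<le> m" if "r < n" for r
    unfolding m_def using that fin by (intro Max_ge) auto
  obtain r0 where r0: "r0 < n" "\<bar>v $ r0\<bar> = m"
    using Max_in[OF fin] unfolding m_def by auto
  obtain r1 where "r1 < n" "v $ r1 \<noteq> 0"
    using v(1,2) by (metis carrier_vecD eq_vecI index_zero_vec)
  hence m: "m > 0" using le[of r1] by linarith
  have orth: "(\<Sum>r<n. F j r * (v $ r / m)) = 0" if j: "j < n" "j \<noteq> i" for j
  proof -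
    have "(A *\<^sub>v v) $ j = (\<Sum>r<n. F j r * v $ r)"
      using j v(1) by (auto simp: A_def scalar_prod_def atLeast0LessThan intro!: sum.cong)
    hence "(\<Sum>r<n. F j r * v $ r) = 0" using v(3) j by simp
    thus ?thesis by (simp flip: sum_divide_distrib)
  qed
  show ?thesis
    using le r0 m orth by (intro exI[of _ "\<lambda>r. v $ r / m"]) (auto simp: abs_mult)
qed

text \<open>
  Let \<open>y\<close> be a unit vector with \<open>M y\<close> small and let \<open>i\<close> be the position of its largest coordinate,
  which is at least \<open>1 / sqrt n\<close> in absolute value. The inner product of \<open>M y\<close> with a vector \<open>x\<close>
  orthogonal to the other columns is \<open>y\<^sub>i \<langle>C\<^sub>i, x\<rangle>\<close>. Each of \<open>1 / \<bar>y\<^sub>i\<bar>\<close> and the norm of \<open>x\<close>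
  contributes a factor \<open>sqrt n\<close>.
\<close>

lemma small_singular_value_imp_dependent_column:
  fixes F :: "nat \<Rightarrow> nat \<Rightarrow> real"
  assumes n: "n > 0" and \<epsilon>: "smallest_singular_value n (mat n n (\<lambda>(r, j). F j r)) \<le> \<epsilon>"
  shows "\<exists>i<n. \<forall>x. (\<forall>r<n. \<bar>x r\<bar> \<le> 1) \<longrightarrow> (\<forall>j<n. j \<noteq> i \<longrightarrow> (\<Sum>r<n. F j r * x r) = 0) \<longrightarrow>
           \<bar>\<Sum>r<n. F i r * x r\<bar> \<le> real n * \<epsilon>"
proof -
  let ?M = "mat n n (\<lambda>(r, j). F j r)"
  obtain y where y: "y \<in> carrier_vec n" "euclidean_norm y = 1"
      "euclidean_norm (?M *\<^sub>v y) = smallest_singular_value n ?M"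
    using smallest_singular_value_attained[of ?M n] n by auto
  have fin: "finite ((\<lambda>j. \<bar>y $ j\<bar>) ` {..<n})" "(\<lambda>j. \<bar>y $ j\<bar>) ` {..<n} \<noteq> {}"
    using n by auto
  obtain i where i: "i < n" "\<bar>y $ i\<bar> = Max ((\<lambda>j. \<bar>y $ j\<bar>) ` {..<n})"
    using Max_in[OF fin] by auto
  have le: "\<bar>y $ j\<bar> \<le> \<bar>y $ i\<bar>" if "j < n" for j
    unfolding i(2) using that fin by (intro Max_ge) auto
  have "1 = (\<Sum>j<n. (y $ j)\<^sup>2)"
    using y(1,2) by (simp add: euclidean_norm_def L2_set_def)
  also have "\<dots> \<le> (\<Sum>j<n. (y $ i)\<^sup>2)"
    using le by (intro sum_mono) (simp add: abs_le_square_iff)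
  finally have yi: "1 \<le> real n * (y $ i)\<^sup>2" by simp
  define u where "u r = (\<Sum>j<n. y $ j * F j r)" for r
  have "euclidean_norm (?M *\<^sub>v y) = L2_set u {..<n}"
    using y(1) unfolding euclidean_norm_def
    by (auto simp: u_def scalar_prod_def atLeast0LessThan mult.commute intro!: L2_set_cong sum.cong)
  hence u: "L2_set u {..<n} \<le> \<epsilon>" using y(3) \<epsilon> by simp
  have "\<bar>\<Sum>r<n. F i r * x r\<bar> \<le> real n * \<epsilon>"
    if x: "\<And>r. r < n \<Longrightarrow> \<bar>x r\<bar> \<le> 1" "\<And>j. j < n \<Longrightarrow> j \<noteq> i \<Longrightarrow> (\<Sum>r<n. F j r * x r) = 0" for x
  proof -
    have "(\<Sum>r<n. u r * x r) = (\<Sum>j<n. y $ j * (\<Sum>r<n. F j r * x r))"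
      unfolding u_def sum_distrib_left sum_distrib_right by (subst sum.swap) (simp add: mult.assoc)
    also have "\<dots> = y $ i * (\<Sum>r<n. F i r * x r)"
      using i(1) x(2) by (subst sum.remove[of _ i]) auto
    finally have "\<bar>y $ i\<bar> * \<bar>\<Sum>r<n. F i r * x r\<bar> = \<bar>\<Sum>r<n. u r * x r\<bar>"
      by (simp add: abs_mult)
    also have "\<dots> \<le> (\<Sum>r<n. \<bar>u r\<bar> * \<bar>x r\<bar>)"
      by (rule order_trans[OF sum_abs]) (simp add: abs_mult)
    also have "\<dots> \<le> L2_set u {..<n} * L2_set x {..<n}"
      by (rule L2_set_mult_ineq)
    also have "L2_set x {..<n} \<le> sqrt (real n)"
    proof -
      have "(\<Sum>r<n. (x r)\<^sup>2) \<le> (\<Sum>r<n. 1)"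
        using x(1) by (intro sum_mono) (simp add: abs_square_le_1)
      thus ?thesis by (simp add: L2_set_def)
    qed
    hence "L2_set u {..<n} * L2_set x {..<n} \<le> \<epsilon> * sqrt (real n)"
      using u by (intro mult_mono) (auto intro: order_trans[OF L2_set_nonneg])
    finally have 1: "\<bar>y $ i\<bar> * \<bar>\<Sum>r<n. F i r * x r\<bar> \<le> \<epsilon> * sqrt (real n)" .
    have 2: "1 \<le> sqrt (real n) * \<bar>y $ i\<bar>"
      using real_sqrt_le_mono[OF yi] by (simp add: real_sqrt_mult)
    have "\<bar>\<Sum>r<n. F i r * x r\<bar> \<le> (sqrt (real n) * \<bar>y $ i\<bar>) * \<bar>\<Sum>r<n. F i r * x r\<bar>"
      using mult_right_mono[OF 2, of "\<bar>\<Sum>r<n. F i r * x r\<bar>"] by simp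
    also have "\<dots> \<le> sqrt (real n) * (\<epsilon> * sqrt (real n))"
      using mult_left_mono[OF 1, of "sqrt (real n)"] by (simp add: mult.assoc)
    also have "\<dots> = real n * \<epsilon>" by (simp add: mult.left_commute)
    finally show ?thesis .
  qed
  thus ?thesis using i(1) by blast
qed

section \<open>Rounding and counting integer vectors\<close>

text \<open>
  The number \<open>\<rho> i\<close> is the distance from a real number to the next lattice point below, and \<open>e i\<close> is
  the error of rounding down or up. The two options have opposite signs, so one of them has a
  nonpositive inner product with the error accumulated so far. The squared errors then add up as
  for independent random signs, although nothing is random here.
\<close>

lemma greedy_rounding:
  fixes F :: "'j \<Rightarrow> nat \<Rightarrow> real"
  assumes C: "finite C" and F: "\<And>j i. j \<in> C \<Longrightarrow> \<bar>F j i\<bar> \<le> 1"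
    and \<rho>: "\<And>i. 0 \<le> \<rho> i" "\<And>i. \<rho> i \<le> \<delta>"
  shows "\<exists>e. (\<forall>i. e i = - \<rho> i \<or> e i = \<delta> - \<rho> i) \<and>
             (\<Sum>j\<in>C. (\<Sum>i<n. F j i * e i)\<^sup>2) \<le> real (card C) * real n * \<delta>\<^sup>2"
proof (induction n)
  case 0
  show ?case by (intro exI[of _ "\<lambda>i. - \<rho> i"]) auto
next
  case (Suc n)
  then obtain e where e: "\<forall>i. e i = - \<rho> i \<or> e i = \<delta> - \<rho> i"
      "(\<Sum>j\<in>C. (\<Sum>i<n. F j i * e i)\<^sup>2) \<le> real (card C) * real n * \<delta>\<^sup>2" by blast
  define S where "S j = (\<Sum>i<n. F j i * e i)" for j
  define a where "a = (if 0 \<le> (\<Sum>j\<in>C. S j * F j n) then - \<rho> n else \<delta> - \<rho> n)"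
  have a: "a = - \<rho> n \<or> a = \<delta> - \<rho> n" by (simp add: a_def)
  have a1: "a * (\<Sum>j\<in>C. S j * F j n) \<le> 0"
    using \<rho>[of n] by (auto simp: a_def mult_le_0_iff)
  have a2: "a\<^sup>2 \<le> \<delta>\<^sup>2"
    using a \<rho>[of n] by (auto simp flip: abs_le_square_iff)
  have "(\<Sum>j\<in>C. (S j + F j n * a)\<^sup>2)
      = (\<Sum>j\<in>C. (S j)\<^sup>2) + 2 * (a * (\<Sum>j\<in>C. S j * F j n)) + a\<^sup>2 * (\<Sum>j\<in>C. (F j n)\<^sup>2)"
    by (simp add: power2_eq_square algebra_simps sum.distrib sum_distrib_left)
  also have "a\<^sup>2 * (\<Sum>j\<in>C. (F j n)\<^sup>2) \<le> \<delta>\<^sup>2 * real (card C)"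
  proof (intro mult_mono a2)
    have "(\<Sum>j\<in>C. (F j n)\<^sup>2) \<le> (\<Sum>j\<in>C. 1)"
      using F by (intro sum_mono) (simp add: abs_square_le_1)
    thus "(\<Sum>j\<in>C. (F j n)\<^sup>2) \<le> real (card C)" by simp
  qed (auto intro: sum_nonneg)
  finally have "(\<Sum>j\<in>C. (S j + F j n * a)\<^sup>2) \<le> real (card C) * real (Suc n) * \<delta>\<^sup>2"
    using a1 e(2) by (simp add: S_def algebra_simps)
  moreover have "(\<Sum>i<Suc n. F j i * (e(n := a)) i) = S j + F j n * a" for j
    by (simp add: S_def)
  ultimately show ?case
    using e(1) a by (intro exI[of _ "e(n := a)"]) auto
qed

text \<open>
  Weighting an integer vector by \<open>2\<close> to the power of minus its \<open>\<ell>\<^sub>1\<close> norm gives total mass at most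
  \<open>3 ^ n\<close>, and every vector of the ball has weight at least \<open>2 ^ - R\<close>.
\<close>

lemma card_l1_ball_le:
  fixes R :: nat
  shows "finite {z \<in> {..<n} \<rightarrow>\<^sub>E UNIV. (\<Sum>i<n. \<bar>z i\<bar>) \<le> int R}"
    and "card {z \<in> {..<n} \<rightarrow>\<^sub>E UNIV. (\<Sum>i<n. \<bar>z i\<bar>) \<le> int R} \<le> 2 ^ R * 3 ^ n"
proof -
  let ?B = "{z \<in> {..<n} \<rightarrow>\<^sub>E UNIV. (\<Sum>i<n. \<bar>z i\<bar>) \<le> int R}"
  let ?D = "{..<n} \<rightarrow>\<^sub>E {- int R..int R}"
  have abs_le: "\<bar>z i\<bar> \<le> int R" if "z \<in> ?B" "i < n" for z i
  proof -
    have "\<bar>z i\<bar> \<le> (\<Sum>i<n. \<bar>z i\<bar>)" using that(2) by (intro member_le_sum) auto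
    thus ?thesis using that(1) by simp
  qed
  have sub: "?B \<subseteq> ?D"
  proof
    fix z assume z: "z \<in> ?B"
    have "z i \<in> {- int R..int R}" if "i < n" for i
      using abs_le[OF z that] by auto
    thus "z \<in> ?D" using z by (simp add: PiE_iff)
  qed
  have finD: "finite ?D" by (intro finite_PiE) auto
  show fin: "finite ?B" by (rule finite_subset[OF sub finD])
  have geo: "(\<Sum>k\<in>{- int R..int R}. (1 / 2 :: real) ^ nat \<bar>k\<bar>) \<le> 3"
  proof -
    have "(\<Sum>k\<in>{- int R..int R}. (1 / 2 :: real) ^ nat \<bar>k\<bar>) = 3 - 2 * (1 / 2) ^ R"
    proof (induction R)
      case (Suc R)
      have "{- int (Suc R)..int (Suc R)} = insert (- int (Suc R)) (insert (int (Suc R)) {- int R..int R})"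
        by auto
      thus ?case using Suc.IH by (simp add: nat_add_distrib)
    qed simp
    thus ?thesis by simp
  qed
  have "real (card ?B) = (\<Sum>z\<in>?B. 1)" by simp
  also have "\<dots> \<le> (\<Sum>z\<in>?B. 2 ^ R * (\<Prod>i<n. (1 / 2) ^ nat \<bar>z i\<bar>))"
  proof (intro sum_mono)
    fix z assume z: "z \<in> ?B"
    have "(\<Prod>i<n. (1 / 2 :: real) ^ nat \<bar>z i\<bar>) = (1 / 2) ^ (\<Sum>i<n. nat \<bar>z i\<bar>)"
      by (simp add: power_sum)
    moreover have "(\<Sum>i<n. nat \<bar>z i\<bar>) \<le> R"
    proof -
      have "int (\<Sum>i<n. nat \<bar>z i\<bar>) = (\<Sum>i<n. \<bar>z i\<bar>)" by simp
      moreover have "(\<Sum>i<n. \<bar>z i\<bar>) \<le> int R" using z by blast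
      ultimately have "int (\<Sum>i<n. nat \<bar>z i\<bar>) \<le> int R" by (simp only:)
      thus ?thesis by (simp only: of_nat_le_iff)
    qed
    ultimately have "(1 / 2 :: real) ^ R \<le> (\<Prod>i<n. (1 / 2) ^ nat \<bar>z i\<bar>)"
      by (simp add: power_decreasing)
    hence "2 ^ R * (1 / 2 :: real) ^ R \<le> 2 ^ R * (\<Prod>i<n. (1 / 2) ^ nat \<bar>z i\<bar>)"
      by (intro mult_left_mono) auto
    thus "1 \<le> 2 ^ R * (\<Prod>i<n. (1 / 2 :: real) ^ nat \<bar>z i\<bar>)"
      by (simp flip: power_mult_distrib)
  qed
  also have "\<dots> \<le> (\<Sum>z\<in>?D. 2 ^ R * (\<Prod>i<n. (1 / 2) ^ nat \<bar>z i\<bar>))"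
    by (intro sum_mono2[OF finD sub] mult_nonneg_nonneg prod_nonneg) simp_all
  also have "\<dots> = 2 ^ R * (\<Prod>i<n. \<Sum>k\<in>{- int R..int R}. (1 / 2) ^ nat \<bar>k\<bar>)"
    by (subst prod_sum_PiE) (auto simp: sum_distrib_left)
  also have "\<dots> \<le> 2 ^ R * 3 ^ n"
    using power_mono[OF geo, of n] by (simp add: sum_nonneg)
  finally show "card ?B \<le> 2 ^ R * 3 ^ n"
    by (metis (mono_tags) of_nat_le_iff of_nat_mult of_nat_numeral of_nat_power)
qed

text \<open>
  A sparse vector is determined by a list of \<open>k\<close> pairs of a position and a value. Vectors with a
  smaller support are listed with the position \<open>0\<close> repeated.
\<close>

lemma card_sparse_le:
  fixes R k :: nat
  assumes n: "n > 0"
  shows "finite {w \<in> {..<n} \<rightarrow>\<^sub>E {- int R..int R}. card {i. i < n \<and> w i \<noteq> 0} \<le> k}"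
    and "card {w \<in> {..<n} \<rightarrow>\<^sub>E {- int R..int R}. card {i. i < n \<and> w i \<noteq> 0} \<le> k} \<le> (n * (2 * R + 1)) ^ k"
proof -
  let ?W = "{w \<in> {..<n} \<rightarrow>\<^sub>E {- int R..int R}. card {i. i < n \<and> w i \<noteq> 0} \<le> k}"
  let ?L = "{L. set L \<subseteq> {..<n} \<times> {- int R..int R} \<and> length L = k}"
  define g where "g L = restrict (\<lambda>i. case map_of L i of None \<Rightarrow> 0 | Some v \<Rightarrow> v) {..<n}"
    for L :: "(nat \<times> int) list"
  show fin: "finite ?W"
    by (rule finite_subset[of _ "{..<n} \<rightarrow>\<^sub>E {- int R..int R}"]) (auto intro!: finite_PiE)
  have "?W \<subseteq> g ` ?L"
  proof
    fix w assume "w \<in> ?W"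
    hence w: "w \<in> {..<n} \<rightarrow>\<^sub>E {- int R..int R}" "card {i. i < n \<and> w i \<noteq> 0} \<le> k"
      by blast+
    obtain xs where xs: "set xs = {i. i < n \<and> w i \<noteq> 0}" "distinct xs"
      using finite_distinct_list[of "{i. i < n \<and> w i \<noteq> 0}"] by auto
    have len: "length xs \<le> k" using w(2) xs(1) distinct_card[OF xs(2)] by simp
    define ys where "ys = xs @ replicate (k - length xs) 0"
    define L where "L = map (\<lambda>i. (i, w i)) ys"
    have "set xs \<subseteq> {..<n}" unfolding xs(1) by blast
    hence ys: "set ys \<subseteq> {..<n}" "set xs \<subseteq> set ys" "length ys = k"
      using n len by (auto simp: ys_def)
    have "(i, w i) \<in> {..<n} \<times> {- int R..int R}" if "i \<in> set ys" for i
    proof -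
      have "i \<in> {..<n}" using that ys(1) by (rule subsetD[rotated])
      thus ?thesis using PiE_mem[OF w(1)] by blast
    qed
    hence "set L \<subseteq> {..<n} \<times> {- int R..int R}"
      unfolding L_def set_map by (rule image_subsetI)
    moreover have "length L = k" using ys(3) by (simp add: L_def)
    ultimately have "L \<in> ?L" by simp
    moreover have "w = g L"
    proof
      fix i show "w i = g L i"
      proof (cases "i < n")
        case True
        have "map_of L i = (if i \<in> set ys then Some (w i) else None)"
          unfolding L_def by (auto simp: map_of_map_restrict restrict_map_def)
        thus ?thesis using True xs ys(2) by (auto simp: g_def)
      next
        case False
        hence "w i = undefined" by (intro PiE_arb[OF w(1)]) simp
        thus ?thesis using False by (simp add: g_def)
      qed
    qed
    ultimately show "w \<in> g ` ?L" by (rule image_eqI[rotated])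
  qed
  moreover have "finite ?L" by (intro finite_lists_length_eq) auto
  ultimately have "card ?W \<le> card ?L"
    by (meson card_image_le card_mono finite_imageI order_trans)
  also have "\<dots> = card ({..<n} \<times> {- int R..int R}) ^ k"
    by (intro card_lists_length_eq) auto
  also have "card ({..<n} \<times> {- int R..int R}) = n * (2 * R + 1)"
  proof -
    have "nat (int R - (- int R) + 1) = 2 * R + 1" by linarith
    thus ?thesis by (simp only: card_cartesian_product card_atLeastAtMost_int card_lessThan)
  qed
  finally show "card ?W \<le> (n * (2 * R + 1)) ^ k" .
qed

section \<open>Concentration and closeness to the integer lattice\<close>

lemma card_le_if_differences_less:
  fixes S :: "nat set"
  assumes "\<And>j l. j \<in> S \<Longrightarrow> l \<in> S \<Longrightarrow> l \<le> j \<Longrightarrow> j - l < D"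
  shows "card S \<le> D"
proof (cases "S = {}")
  case False
  define m where "m = (LEAST j. j \<in> S)"
  have m: "m \<in> S" "\<And>j. j \<in> S \<Longrightarrow> m \<le> j"
    using False unfolding m_def by (auto intro: LeastI Least_le)
  have "S \<subseteq> {m..<m + D}"
  proof
    fix j assume j: "j \<in> S"
    show "j \<in> {m..<m + D}" using assms[OF j m(1) m(2)[OF j]] m(2)[OF j] by auto
  qed
  hence "card S \<le> card {m..<m + D}" by (intro card_mono) auto
  thus ?thesis by simp
qed simp

definition lattice_dist2 :: "'i set \<Rightarrow> ('i \<Rightarrow> real) \<Rightarrow> real" where
  "lattice_dist2 J u = (\<Sum>i\<in>J. (idist (u i))\<^sup>2)"

lemma lattice_dist2_diff_le:
  "lattice_dist2 J (\<lambda>i. u i - w i) \<le> 2 * lattice_dist2 J u + 2 * lattice_dist2 J w"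
proof -
  have "(idist (u i - w i))\<^sup>2 \<le> 2 * (idist (u i))\<^sup>2 + 2 * (idist (w i))\<^sup>2" for i
  proof -
    have "(idist (u i - w i))\<^sup>2 \<le> (idist (u i) + idist (w i))\<^sup>2"
      by (intro power_mono idist_diff_le idist_nonneg)
    thus ?thesis using square_add_le[of "idist (u i)" "idist (w i)"] by linarith
  qed
  hence "lattice_dist2 J (\<lambda>i. u i - w i) \<le> (\<Sum>i\<in>J. 2 * (idist (u i))\<^sup>2 + 2 * (idist (w i))\<^sup>2)"
    unfolding lattice_dist2_def by (intro sum_mono)
  thus ?thesis by (simp add: lattice_dist2_def sum.distrib sum_distrib_left)
qed

lemma lattice_dist2_perturb:
  assumes "\<And>i. i \<in> J \<Longrightarrow> \<bar>u i - w i\<bar> \<le> \<epsilon>"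
  shows "lattice_dist2 J u \<le> 2 * lattice_dist2 J w + 2 * (real (card J) * \<epsilon>\<^sup>2)"
proof -
  have "(idist (u i))\<^sup>2 \<le> 2 * (idist (w i))\<^sup>2 + 2 * \<epsilon>\<^sup>2" if i: "i \<in> J" for i
  proof -
    have "idist (u i) \<le> idist (w i) + \<bar>u i - w i\<bar>"
      using idist_add_le[of "w i" "u i - w i"] by simp
    hence "idist (u i) \<le> idist (w i) + \<epsilon>" using assms[OF i] by linarith
    hence "(idist (u i))\<^sup>2 \<le> (idist (w i) + \<epsilon>)\<^sup>2"
      by (intro power_mono idist_nonneg)
    thus ?thesis using square_add_le[of "idist (w i)" \<epsilon>] by linarith
  qed
  hence "lattice_dist2 J u \<le> (\<Sum>i\<in>J. 2 * (idist (w i))\<^sup>2 + 2 * \<epsilon>\<^sup>2)"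
    unfolding lattice_dist2_def by (intro sum_mono)
  thus ?thesis by (simp add: lattice_dist2_def sum.distrib sum_distrib_left mult.left_commute)
qed

text \<open>
  Frequencies far from the lattice contribute a negligible exponential, so only the number of
  frequencies close to the lattice matters.
\<close>

lemma small_ball_card:
  fixes v :: "nat \<Rightarrow> real"
  assumes \<mu>: "0 \<le> \<mu>" "\<mu> \<le> 1" and J: "J \<subseteq> {..<n}" and N: "N > 0" and \<eta>: "\<eta> > 0"
  shows "measure_pmf.prob (column_pmf \<mu> n) {X. \<bar>\<Sum>r<n. X r * v r\<bar> \<le> 1 / (3 * \<eta> * real N)}
           \<le> 8 / real N * real (card {j. j < N \<and> lattice_dist2 J (\<lambda>i. \<eta> * real j * v i) \<le> \<Lambda>})
             + 8 * exp (- (\<mu>\<^sup>2 / 2) * \<Lambda>)"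
proof -
  let ?g = "\<lambda>j::nat. lattice_dist2 J (\<lambda>i. \<eta> * real j * v i)"
  have g0: "0 \<le> ?g j" for j by (simp add: lattice_dist2_def sum_nonneg)
  have "(\<Sum>j<N. exp (- (\<mu>\<^sup>2 / 2) * ?g j)) \<le> (\<Sum>j<N. of_bool (?g j \<le> \<Lambda>) + exp (- (\<mu>\<^sup>2 / 2) * \<Lambda>))"
  proof (intro sum_mono)
    fix j
    show "exp (- (\<mu>\<^sup>2 / 2) * ?g j) \<le> of_bool (?g j \<le> \<Lambda>) + exp (- (\<mu>\<^sup>2 / 2) * \<Lambda>)"
    proof (cases "?g j \<le> \<Lambda>")
      case True
      have "exp (- (\<mu>\<^sup>2 / 2) * ?g j) \<le> 1" using g0[of j] by simp
      thus ?thesis using True by (simp add: add_increasing2)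
    next
      case False
      thus ?thesis by (simp add: mult_left_mono)
    qed
  qed
  also have "\<dots> = real (card {j. j < N \<and> ?g j \<le> \<Lambda>}) + real N * exp (- (\<mu>\<^sup>2 / 2) * \<Lambda>)"
  proof -
    have "(\<Sum>j<N. of_bool (?g j \<le> \<Lambda>)) = real (card ({..<N} \<inter> {j. ?g j \<le> \<Lambda>}))"
      by (simp add: of_bool_def sum.If_cases)
    also have "{..<N} \<inter> {j. ?g j \<le> \<Lambda>} = {j. j < N \<and> ?g j \<le> \<Lambda>}" by auto
    finally show ?thesis by (simp add: sum.distrib)
  qed
  finally have *: "(\<Sum>j<N. exp (- (\<mu>\<^sup>2 / 2) * ?g j))
      \<le> real (card {j. j < N \<and> ?g j \<le> \<Lambda>}) + real N * exp (- (\<mu>\<^sup>2 / 2) * \<Lambda>)" .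
  have "measure_pmf.prob (column_pmf \<mu> n) {X. \<bar>\<Sum>r<n. X r * v r\<bar> \<le> 1 / (3 * \<eta> * real N)}
      \<le> 8 / real N * (\<Sum>j<N. exp (- (\<mu>\<^sup>2 / 2) * ?g j))"
    unfolding column_pmf_def lattice_dist2_def by (intro small_ball \<mu> J N \<eta>) auto
  also have "\<dots> \<le> 8 / real N * (real (card {j. j < N \<and> ?g j \<le> \<Lambda>}) + real N * exp (- (\<mu>\<^sup>2 / 2) * \<Lambda>))"
    by (intro mult_left_mono *) auto
  also have "\<dots> = 8 / real N * real (card {j. j < N \<and> ?g j \<le> \<Lambda>}) + 8 * exp (- (\<mu>\<^sup>2 / 2) * \<Lambda>)"
    using N by (simp add: field_simps)
  finally show ?thesis .
qed

lemma lattice_dist2_diff_multiples: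
  assumes "l \<le> j" "lattice_dist2 J (\<lambda>i. h * real j * v i) \<le> \<Lambda>" "lattice_dist2 J (\<lambda>i. h * real l * v i) \<le> \<Lambda>"
  shows "lattice_dist2 J (\<lambda>i. h * real (j - l) * v i) \<le> 4 * \<Lambda>"
proof -
  have "(\<lambda>i. h * real (j - l) * v i) = (\<lambda>i. h * real j * v i - h * real l * v i)"
    using assms(1) by (auto simp: of_nat_diff algebra_simps)
  thus ?thesis
    using lattice_dist2_diff_le[of J "\<lambda>i. h * real j * v i" "\<lambda>i. h * real l * v i"] assms(2,3) by simp
qed

text \<open>
  If no multiple beyond \<open>D\<close> were close to the lattice, then any two of the frequencies counted by
  \<open>small_ball_card\<close> would differ by less than \<open>D\<close>, as closeness to a lattice is inherited by
  differences. So there would be at most \<open>D\<close> of them, too few for the assumed concentration.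
\<close>

lemma concentration_imp_near_lattice_multiple:
  fixes v :: "nat \<Rightarrow> real"
  assumes \<mu>: "0 \<le> \<mu>" "\<mu> \<le> 1" and J: "J \<subseteq> {..<n}" and N: "N > 0" and h: "h > 0"
    and conc: "8 * real D / real N + 8 * exp (- (\<mu>\<^sup>2 / 2) * \<Lambda>)
      < measure_pmf.prob (column_pmf \<mu> n) {X. \<bar>\<Sum>r<n. X r * v r\<bar> \<le> 1 / (3 * h * real N)}"
  shows "\<exists>d. D \<le> d \<and> d < N \<and> lattice_dist2 J (\<lambda>i. h * real d * v i) \<le> 4 * \<Lambda>"
proof (rule ccontr)
  assume no: "\<not> ?thesis"
  let ?S = "{j. j < N \<and> lattice_dist2 J (\<lambda>i. h * real j * v i) \<le> \<Lambda>}"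
  have "card ?S \<le> D"
  proof (rule card_le_if_differences_less)
    fix j l assume "j \<in> ?S" "l \<in> ?S" "l \<le> j"
    hence "lattice_dist2 J (\<lambda>i. h * real (j - l) * v i) \<le> 4 * \<Lambda>" "j - l < N"
      using lattice_dist2_diff_multiples[of l j J h v \<Lambda>] by auto
    thus "j - l < D" using no by (meson not_le)
  qed
  hence "8 / real N * real (card ?S) \<le> 8 / real N * real D"
    by (intro mult_left_mono) auto
  thus False
    using small_ball_card[OF \<mu> J N h, of v \<Lambda>] conc by simp
qed

text \<open>
  The converse direction, for a vector \<open>y\<close> close to the multiple \<open>h d v\<close>. In units of \<open>1 / d\<close>, the
  frequency \<open>j\<close> of \<open>y\<close> corresponds to the multiple \<open>h j\<close> of \<open>v\<close>. The perturbation is harmless because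
  only \<open>j < N\<close> occur, which scales the rounding error by \<open>N / d\<close>. Since \<open>N \<le> d\<close>, the differences of
  the relevant frequencies are less than \<open>d\<close>, and the gap assumption forces them below \<open>D\<close>.
\<close>

lemma anticoncentration_of_rounding:
  fixes v y :: "nat \<Rightarrow> real"
  assumes \<mu>: "0 \<le> \<mu>" "\<mu> \<le> 1" and J: "J \<subseteq> {..<n}" and N: "0 < N" "N \<le> d"
    and y: "\<And>i. i \<in> J \<Longrightarrow> \<bar>y i - h * real d * v i\<bar> \<le> \<delta>"
    and \<delta>: "2 * (real n * (real N / real d * \<delta>)\<^sup>2) \<le> 1" "0 \<le> \<delta>"
    and gap: "\<And>j. D \<le> j \<Longrightarrow> j < d \<Longrightarrow> 4 * (2 * \<Lambda> + 1) < lattice_dist2 J (\<lambda>i. h * real j * v i)"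
  shows "measure_pmf.prob (column_pmf \<mu> n) {X. \<bar>\<Sum>r<n. X r * y r\<bar> \<le> real d / (3 * real N)}
           \<le> 8 * real D / real N + 8 * exp (- (\<mu>\<^sup>2 / 2) * \<Lambda>)"
proof -
  let ?S = "{j. j < N \<and> lattice_dist2 J (\<lambda>i. 1 / real d * real j * y i) \<le> \<Lambda>}"
  have transfer: "lattice_dist2 J (\<lambda>i. h * real j * v i) \<le> 2 * \<Lambda> + 1" if j: "j \<in> ?S" for j
  proof -
    have "\<bar>h * real j * v i - 1 / real d * real j * y i\<bar> \<le> real N / real d * \<delta>" if i: "i \<in> J" for i
    proof -
      have "h * real j * v i - 1 / real d * real j * y i = real j / real d * (h * real d * v i - y i)"
        using N by (simp add: field_simps)
      hence "\<bar>h * real j * v i - 1 / real d * real j * y i\<bar> = real j / real d * \<bar>y i - h * real d * v i\<bar>"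
        by (simp add: abs_mult abs_minus_commute)
      also have "\<dots> \<le> real N / real d * \<delta>"
        using j y[OF i] by (intro mult_mono divide_right_mono) auto
      finally show ?thesis .
    qed
    hence "lattice_dist2 J (\<lambda>i. h * real j * v i) \<le> 2 * lattice_dist2 J (\<lambda>i. 1 / real d * real j * y i)
        + 2 * (real (card J) * (real N / real d * \<delta>)\<^sup>2)"
      by (rule lattice_dist2_perturb)
    moreover have "real (card J) * (real N / real d * \<delta>)\<^sup>2 \<le> real n * (real N / real d * \<delta>)\<^sup>2"
      using card_mono[OF _ J] by (intro mult_right_mono) auto
    ultimately show ?thesis using j \<delta>(1) by simp
  qed
  have "card ?S \<le> D"
  proof (rule card_le_if_differences_less)
    fix j l assume jl: "j \<in> ?S" "l \<in> ?S" "l \<le> j"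
    have "lattice_dist2 J (\<lambda>i. h * real (j - l) * v i) \<le> 4 * (2 * \<Lambda> + 1)"
      using lattice_dist2_diff_multiples[OF jl(3) transfer[OF jl(1)] transfer[OF jl(2)]] .
    moreover have "j - l < d" using jl N by auto
    ultimately show "j - l < D" using gap[of "j - l"] by (meson not_le)
  qed
  hence "8 / real N * real (card ?S) \<le> 8 / real N * real D"
    by (intro mult_left_mono) auto
  thus ?thesis
    using small_ball_card[OF \<mu> J N(1), of "1 / real d" y \<Lambda>] N by simp
qed

text \<open>
  Small multiples of \<open>v\<close> have all coordinates of absolute value at most \<open>1/2\<close>, so their nearest
  lattice point is zero and the coordinates of order at least \<open>1\<close> keep them away from it. This
  separates the trivial closeness to the lattice for tiny \<open>t\<close> from genuine arithmetic structure.
\<close>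

lemma near_lattice_multiple_lower_bound:
  fixes v :: "nat \<Rightarrow> real"
  assumes J: "finite J" "K \<subseteq> J" and v: "\<And>i. i \<in> K \<Longrightarrow> 1 \<le> \<bar>v i\<bar>" "\<And>i. i \<in> K \<Longrightarrow> \<bar>v i\<bar> \<le> V"
    and t: "0 \<le> t" "t * V \<le> 1 / 2"
  shows "t\<^sup>2 * real (card K) \<le> lattice_dist2 J (\<lambda>i. t * v i)"
proof -
  have "t\<^sup>2 * real (card K) = (\<Sum>i\<in>K. t\<^sup>2)" by simp
  also have "\<dots> \<le> (\<Sum>i\<in>K. (idist (t * v i))\<^sup>2)"
  proof (intro sum_mono)
    fix i assume i: "i \<in> K"
    have "\<bar>t * v i\<bar> \<le> t * V" using t v(2)[OF i] by (simp add: abs_mult mult_left_mono)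
    hence "idist (t * v i) = t * \<bar>v i\<bar>"
      using t by (subst idist_small) (auto simp: abs_mult)
    moreover have "t * 1 \<le> t * \<bar>v i\<bar>" using t v(1)[OF i] by (intro mult_left_mono) auto
    ultimately show "t\<^sup>2 \<le> (idist (t * v i))\<^sup>2" using t(1) by (intro power_mono) auto
  qed
  also have "\<dots> \<le> lattice_dist2 J (\<lambda>i. t * v i)"
    unfolding lattice_dist2_def using J by (intro sum_mono2) auto
  finally show ?thesis .
qed

section \<open>Approximation by structured vectors\<close>

lemma round_to_fine_lattice:
  fixes F :: "'j \<Rightarrow> nat \<Rightarrow> real" and y :: "nat \<Rightarrow> real" and p :: "nat \<Rightarrow> int"
  assumes C: "finite C" and F: "\<And>j i. j \<in> C \<Longrightarrow> \<bar>F j i\<bar> \<le> 1"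
    and orth: "\<And>j. j \<in> C \<Longrightarrow> (\<Sum>i<n. F j i * y i) = 0" and \<delta>: "\<delta> > 0"
  shows "\<exists>z :: nat \<Rightarrow> int. (\<forall>i. \<bar>of_int (p i) + \<delta> * of_int (z i) - y i\<bar> \<le> \<delta>) \<and>
           (\<Sum>j\<in>C. (\<Sum>i<n. F j i * (of_int (p i) + \<delta> * of_int (z i)))\<^sup>2) \<le> real (card C) * real n * \<delta>\<^sup>2"
proof -
  define t where "t i = (y i - of_int (p i)) / \<delta>" for i
  define \<rho> where "\<rho> i = \<delta> * frac (t i)" for i
  have \<rho>: "0 \<le> \<rho> i" "\<rho> i \<le> \<delta>" for i
    using \<delta> frac_lt_1[of "t i"] by (auto simp: \<rho>_def intro: mult_left_le)
  obtain e where e: "\<And>i. e i = - \<rho> i \<or> e i = \<delta> - \<rho> i"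
      "(\<Sum>j\<in>C. (\<Sum>i<n. F j i * e i)\<^sup>2) \<le> real (card C) * real n * \<delta>\<^sup>2"
    using greedy_rounding[of C F \<rho> \<delta> n] C F \<rho> by blast
  define z where "z i = \<lfloor>t i\<rfloor> + (if e i = - \<rho> i then 0 else 1)" for i
  have y: "y i = of_int (p i) + \<delta> * of_int \<lfloor>t i\<rfloor> + \<rho> i" for i
    using \<delta> by (simp add: \<rho>_def frac_def t_def field_simps)
  have z: "of_int (p i) + \<delta> * of_int (z i) = y i + e i" for i
    using e(1)[of i] by (auto simp: z_def y[of i] algebra_simps)
  have "\<bar>e i\<bar> \<le> \<delta>" for i using e(1)[of i] \<rho>[of i] \<delta> by linarith
  moreover have "(\<Sum>i<n. F j i * (y i + e i)) = (\<Sum>i<n. F j i * e i)" if "j \<in> C" for j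
    using orth[OF that] by (simp add: distrib_left sum.distrib)
  ultimately show ?thesis
    using e(2) by (intro exI[of _ z]) (simp add: z)
qed

definition sparse_vectors :: "nat \<Rightarrow> nat \<Rightarrow> nat \<Rightarrow> (nat \<Rightarrow> int) set" where
  "sparse_vectors n k R = {w \<in> {..<n} \<rightarrow>\<^sub>E {- int R..int R}. card {i. i < n \<and> w i \<noteq> 0} \<le> k}"

definition l1_ball :: "nat \<Rightarrow> nat \<Rightarrow> (nat \<Rightarrow> int) set" where
  "l1_ball n R = {z \<in> {..<n} \<rightarrow>\<^sub>E UNIV. (\<Sum>i<n. \<bar>z i\<bar>) \<le> int R}"

text \<open>
  Roundings of a real vector that is close to the integer lattice up to a few coordinates: \<open>p\<close>
  is the nearest lattice point, the part \<open>b\<close> of small \<open>\<ell>\<^sub>1\<close> norm refines it to precision \<open>\<delta>\<close>, and the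
  sparse part \<open>s\<close> stands for the few exceptional coordinates. There are far fewer such vectors than
  points of precision \<open>\<delta>\<close> in a box, which would cost a factor \<open>1 / \<delta>\<close> for every coordinate.
\<close>

definition structured_vectors :: "nat \<Rightarrow> real \<Rightarrow> nat \<Rightarrow> nat \<Rightarrow> nat \<Rightarrow> nat \<Rightarrow> (nat \<Rightarrow> real) set" where
  "structured_vectors n \<delta> P k R Q =
     (\<lambda>(p, s, b) i. of_int (p i) + \<delta> * (of_int (s i) + of_int (b i))) `
       (({..<n} \<rightarrow>\<^sub>E {- int P..int P}) \<times> sparse_vectors n k R \<times> l1_ball n Q)"

lemma structured_vectors_card:
  assumes "n > 0"
  shows "finite (structured_vectors n \<delta> P k R Q)"
    and "card (structured_vectors n \<delta> P k R Q) \<le> (2 * P + 1) ^ n * (n * (2 * R + 1)) ^ k * (2 ^ Q * 3 ^ n)"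
proof -
  let ?A = "{..<n} \<rightarrow>\<^sub>E {- int P..int P}"
  have fin: "finite ?A" "finite (sparse_vectors n k R)" "finite (l1_ball n Q)"
    unfolding sparse_vectors_def l1_ball_def
    by (intro finite_PiE; simp) (rule card_sparse_le[OF assms] card_l1_ball_le)+
  hence fin': "finite (?A \<times> sparse_vectors n k R \<times> l1_ball n Q)" by (intro finite_cartesian_product)
  show "finite (structured_vectors n \<delta> P k R Q)"
    unfolding structured_vectors_def by (rule finite_imageI[OF fin'])
  have "card (structured_vectors n \<delta> P k R Q) \<le> card (?A \<times> sparse_vectors n k R \<times> l1_ball n Q)"
    unfolding structured_vectors_def by (rule card_image_le[OF fin'])
  also have "\<dots> = card ?A * card (sparse_vectors n k R) * card (l1_ball n Q)"
    by (simp add: card_cartesian_product mult.assoc)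
  also have "\<dots> \<le> (2 * P + 1) ^ n * (n * (2 * R + 1)) ^ k * (2 ^ Q * 3 ^ n)"
  proof (intro mult_le_mono)
    have "nat (int P - (- int P) + 1) = 2 * P + 1" by linarith
    hence "card ?A = (2 * P + 1) ^ n"
      by (simp only: card_PiE finite_lessThan card_atLeastAtMost_int prod_constant card_lessThan)
    thus "card ?A \<le> (2 * P + 1) ^ n" by simp
    show "card (sparse_vectors n k R) \<le> (n * (2 * R + 1)) ^ k"
      unfolding sparse_vectors_def by (rule card_sparse_le[OF assms])
    show "card (l1_ball n Q) \<le> 2 ^ Q * 3 ^ n"
      unfolding l1_ball_def by (rule card_l1_ball_le)
  qed
  finally show "card (structured_vectors n \<delta> P k R Q) \<le> (2 * P + 1) ^ n * (n * (2 * R + 1)) ^ k * (2 ^ Q * 3 ^ n)" .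
qed

text \<open>
  The core of the argument. Let \<open>d\<close> be minimal such that \<open>h d v\<close> is close to the lattice on \<open>J\<close>. Then
  \<open>h d v\<close> can be rounded to a structured vector that is anticoncentrated, by minimality of \<open>d\<close>, and
  still nearly orthogonal to the columns in the mean square. The fine part of the rounding has
  \<open>\<ell>\<^sub>1\<close> norm at most \<open>3 n\<close> since \<open>\<delta>\<close> is at least the root mean square of the distances of the
  coordinates from the integers, so that the fine part can be counted at a cost exponential in \<open>n\<close>.
\<close>

lemma structured_approximation:
  fixes F :: "'j \<Rightarrow> nat \<Rightarrow> real" and v :: "nat \<Rightarrow> real"
  assumes \<mu>: "0 \<le> \<mu>" "\<mu> \<le> 1"
    and C: "finite C" and F: "\<And>j i. j \<in> C \<Longrightarrow> \<bar>F j i\<bar> \<le> 1"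
    and orth: "\<And>j. j \<in> C \<Longrightarrow> (\<Sum>i<n. F j i * v i) = 0"
    and J: "J \<subseteq> {..<n}" "card ({..<n} - J) \<le> k" and V: "\<And>i. i \<in> J \<Longrightarrow> \<bar>v i\<bar> \<le> V"
    and U: "\<And>i. i < n \<Longrightarrow> \<bar>v i\<bar> \<le> U" "h * real d * U / \<delta> + 1 \<le> real R"
    and \<delta>: "0 < \<delta>" "24 * \<Lambda> \<le> real n * \<delta>\<^sup>2" and h: "0 < h"
    and s: "1 \<le> s" "real n * \<delta>\<^sup>2 \<le> s\<^sup>2" "3 * s \<le> real d"
    and near: "lattice_dist2 J (\<lambda>i. h * real d * v i) \<le> 12 * \<Lambda>" and \<Lambda>: "1 \<le> \<Lambda>"
    and gap: "\<And>j. D \<le> j \<Longrightarrow> j < d \<Longrightarrow> 12 * \<Lambda> < lattice_dist2 J (\<lambda>i. h * real j * v i)"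
  shows "\<exists>y \<in> structured_vectors n \<delta> (nat \<lfloor>h * real d * V\<rfloor> + 1) k R (3 * n).
           measure_pmf.prob (column_pmf \<mu> n) {X. \<bar>\<Sum>r<n. X r * y r\<bar> \<le> s}
             \<le> 48 * s * real D / real d + 8 * exp (- (\<mu>\<^sup>2 / 2) * \<Lambda>) \<and>
           (\<Sum>j\<in>C. (\<Sum>r<n. F j r * y r)\<^sup>2) \<le> real (card C) * real n * \<delta>\<^sup>2"
proof -
  define u where "u i = h * real d * v i" for i
  define p where "p i = (if i \<in> J then round (u i) else 0)" for i
  have d: "real d > 0" using s by linarith
  have orth': "(\<Sum>i<n. F j i * u i) = 0" if "j \<in> C" for j
  proof -
    have "(\<Sum>i<n. F j i * u i) = h * real d * (\<Sum>i<n. F j i * v i)"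
      by (simp add: u_def sum_distrib_left algebra_simps)
    thus ?thesis using orth[OF that] by simp
  qed
  obtain z where z: "\<And>i. \<bar>of_int (p i) + \<delta> * of_int (z i) - u i\<bar> \<le> \<delta>"
      "(\<Sum>j\<in>C. (\<Sum>i<n. F j i * (of_int (p i) + \<delta> * of_int (z i)))\<^sup>2) \<le> real (card C) * real n * \<delta>\<^sup>2"
    using round_to_fine_lattice[where p = p and F = F and y = u and C = C and n = n, OF C F orth' \<delta>(1)] by blast
  have z_bound: "\<bar>of_int (z i)\<bar> \<le> \<bar>u i - of_int (p i)\<bar> / \<delta> + (1::real)" for i
  proof -
    have "\<delta> * \<bar>of_int (z i)\<bar> = \<bar>\<delta> * of_int (z i)\<bar>"
      using \<delta>(1) by (simp add: abs_mult)
    also have "\<dots> \<le> \<bar>u i - of_int (p i)\<bar> + \<delta>"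
      using z(1)[of i] by linarith
    finally show ?thesis using \<delta>(1) by (simp add: field_simps)
  qed
  define p' where "p' = restrict p {..<n}"
  define a where "a = restrict (\<lambda>i. if i \<in> J then 0 else z i) {..<n}"
  define b where "b = restrict (\<lambda>i. if i \<in> J then z i else 0) {..<n}"
  define y :: "nat \<Rightarrow> real" where "y = (\<lambda>i. of_int (p' i) + \<delta> * (of_int (a i) + of_int (b i)))"
  have y: "y i = of_int (p i) + \<delta> * of_int (z i)" if "i < n" for i
    using that by (simp add: y_def p'_def a_def b_def)
  have sum_y: "(\<Sum>i<n. g i * y i) = (\<Sum>i<n. g i * (of_int (p i) + \<delta> * of_int (z i)))" for g :: "nat \<Rightarrow> real"
    by (intro sum.cong) (auto simp: y)
  define P where "P = nat \<lfloor>h * real d * V\<rfloor> + 1"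
  have "p i \<in> {- int P..int P}" for i
  proof (cases "i \<in> J")
    case True
    have "\<bar>u i\<bar> \<le> h * real d * V"
      unfolding u_def using V[OF True] h d by (simp add: abs_mult mult_left_mono)
    moreover have "\<bar>of_int (p i) - u i\<bar> \<le> 1 / 2"
      using of_int_round_abs_le[of "u i"] True by (simp add: p_def)
    moreover have "h * real d * V < real P"
      unfolding P_def by linarith
    ultimately have "\<bar>of_int (p i)\<bar> < real P + 1" by linarith
    hence "\<bar>p i\<bar> \<le> int P" by linarith
    thus ?thesis by (simp add: abs_le_iff)
  qed (simp add: p_def)
  hence 1: "p' \<in> {..<n} \<rightarrow>\<^sub>E {- int P..int P}"
    unfolding p'_def by (intro restrict_PiE_iff[THEN iffD2] ballI)
  have 2: "a \<in> sparse_vectors n k R"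
  proof -
    have "a i \<in> {- int R..int R}" if i: "i < n" for i
    proof (cases "i \<in> J")
      case False
      have "\<bar>u i\<bar> / \<delta> \<le> h * real d * U / \<delta>"
        unfolding u_def using U(1)[OF i] h d \<delta>(1) by (simp add: abs_mult mult_left_mono divide_right_mono)
      hence "\<bar>of_int (z i)\<bar> \<le> real R"
        using z_bound[of i] U(2) False by (simp add: p_def)
      hence "\<bar>z i\<bar> \<le> int R" by linarith
      thus ?thesis using False i by (simp add: a_def abs_le_iff)
    qed (use i in \<open>simp add: a_def\<close>)
    hence "a \<in> {..<n} \<rightarrow>\<^sub>E {- int R..int R}" by (auto simp: PiE_iff a_def)
    moreover have "card {i. i < n \<and> a i \<noteq> 0} \<le> card ({..<n} - J)"
      by (intro card_mono) (auto simp: a_def split: if_splits)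
    ultimately show ?thesis using J(2) by (simp add: sparse_vectors_def)
  qed
  have 3: "b \<in> l1_ball n (3 * n)"
  proof -
    have "(\<Sum>i<n. \<bar>b i\<bar>) = (\<Sum>i\<in>J. \<bar>z i\<bar>)"
    proof -
      have "(\<Sum>i<n. \<bar>b i\<bar>) = (\<Sum>i<n. if i \<in> J then \<bar>z i\<bar> else 0)"
        by (intro sum.cong) (auto simp: b_def)
      thus ?thesis using J(1) by (simp add: sum.If_cases Int_absorb1)
    qed
    moreover have "real_of_int (\<Sum>i\<in>J. \<bar>z i\<bar>) \<le> 3 * real n"
    proof -
      have term_le: "real_of_int \<bar>z i\<bar> \<le> 2 * ((idist (u i))\<^sup>2 / \<delta>\<^sup>2) + 2" if i: "i \<in> J" for i
      proof -
        have "real_of_int \<bar>z i\<bar> \<le> (real_of_int \<bar>z i\<bar>)\<^sup>2"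
        proof (cases "z i = 0")
          case False
          hence "1 \<le> real_of_int \<bar>z i\<bar>" by linarith
          thus ?thesis by (rule self_le_power) simp
        qed simp
        also have "\<dots> \<le> (idist (u i) / \<delta> + 1)\<^sup>2"
          using z_bound[of i] i by (intro power_mono) (auto simp: p_def idist_def)
        also have "\<dots> \<le> 2 * (idist (u i) / \<delta>)\<^sup>2 + 2"
          using square_add_le[of "idist (u i) / \<delta>" 1] by simp
        finally show ?thesis by (simp add: power_divide)
      qed
      have "real_of_int (\<Sum>i\<in>J. \<bar>z i\<bar>) \<le> (\<Sum>i\<in>J. 2 * ((idist (u i))\<^sup>2 / \<delta>\<^sup>2) + 2)"
        using term_le by (simp only: of_int_sum) (intro sum_mono)
      also have "\<dots> = 2 / \<delta>\<^sup>2 * lattice_dist2 J u + 2 * real (card J)"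
        by (simp add: sum.distrib lattice_dist2_def sum_distrib_left)
      also have "\<dots> \<le> 2 / \<delta>\<^sup>2 * (12 * \<Lambda>) + 2 * real n"
        using near card_mono[OF _ J(1)] unfolding u_def
        by (intro add_mono mult_left_mono) auto
      also have "2 / \<delta>\<^sup>2 * (12 * \<Lambda>) \<le> real n"
        using \<delta> by (simp add: field_simps)
      finally show ?thesis by simp
    qed
    ultimately have "real_of_int (\<Sum>i<n. \<bar>b i\<bar>) \<le> real_of_int (int (3 * n))"
      by (simp only: of_int_of_nat_eq of_nat_mult)
    hence "(\<Sum>i<n. \<bar>b i\<bar>) \<le> int (3 * n)" by (simp only: of_int_le_iff)
    moreover have "b \<in> {..<n} \<rightarrow>\<^sub>E UNIV" by (simp add: b_def)
    ultimately show ?thesis unfolding l1_ball_def by blast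
  qed
  have mem: "y \<in> structured_vectors n \<delta> P k R (3 * n)"
    unfolding structured_vectors_def y_def using 1 2 3 by (intro image_eqI[of _ _ "(p', a, b)"]) auto
  \<comment> \<open>The largest number of frequencies for which the interval of width \<open>s\<close> is still resolved.\<close>
  define N where "N = nat \<lfloor>real d / (3 * s)\<rfloor>"
  have q1: "1 \<le> real d / (3 * s)" using s by (simp add: field_simps)
  have N0: "0 < N" using q1 by (simp add: N_def)
  have N_le: "real N \<le> real d / (3 * s)" and "real d / (3 * s) < real N + 1"
    using q1 unfolding N_def by linarith+
  moreover have "1 \<le> real N" using N0 by simp
  moreover have "real d / (6 * s) = real d / (3 * s) / 2" by simp
  ultimately have N_ge: "real d / (6 * s) \<le> real N" by linarith
  have "real N * (3 * s) \<le> real d" using N_le s by (simp add: field_simps)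
  moreover have "real N * 1 \<le> real N * (3 * s)" using s by (intro mult_left_mono) auto
  ultimately have Nd: "N \<le> d" by linarith
  have "measure_pmf.prob (column_pmf \<mu> n) {X. \<bar>\<Sum>r<n. X r * y r\<bar> \<le> s}
      \<le> measure_pmf.prob (column_pmf \<mu> n) {X. \<bar>\<Sum>r<n. X r * y r\<bar> \<le> real d / (3 * real N)}"
  proof (intro measure_pmf.finite_measure_mono)
    have "s \<le> real d / (3 * real N)" using N_le N0 s by (simp add: field_simps)
    thus "{X. \<bar>\<Sum>r<n. X r * y r\<bar> \<le> s} \<subseteq> {X. \<bar>\<Sum>r<n. X r * y r\<bar> \<le> real d / (3 * real N)}" by auto
  qed simp
  also have "\<dots> \<le> 8 * real D / real N + 8 * exp (- (\<mu>\<^sup>2 / 2) * \<Lambda>)"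
  proof (rule anticoncentration_of_rounding[OF \<mu> J(1) N0 Nd])
    show "\<bar>y i - h * real d * v i\<bar> \<le> \<delta>" if "i \<in> J" for i
      using z(1)[of i] y[of i] J(1) that by (auto simp: u_def)
    have "real N / real d \<le> 1 / (3 * s)" using N_le d by (simp add: field_simps)
    hence "(real N / real d * \<delta>)\<^sup>2 \<le> (1 / (3 * s) * \<delta>)\<^sup>2"
      using \<delta>(1) by (intro power_mono mult_right_mono) auto
    hence "real n * (real N / real d * \<delta>)\<^sup>2 \<le> real n * (1 / (3 * s) * \<delta>)\<^sup>2"
      by (intro mult_left_mono) auto
    also have "\<dots> \<le> 1 / 9"
      using s by (simp add: power_mult_distrib power_divide field_simps)
    finally show "2 * (real n * (real N / real d * \<delta>)\<^sup>2) \<le> 1" by simp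
    show "0 \<le> \<delta>" using \<delta>(1) by simp
    show "4 * (2 * \<Lambda> + 1) < lattice_dist2 J (\<lambda>i. h * real j * v i)" if "D \<le> j" "j < d" for j
      by (rule le_less_trans[OF _ gap[OF that]]) (use \<Lambda> in simp)
  qed
  also have "8 * real D / real N \<le> 8 * real D / (real d / (6 * s))"
    using N_ge d s by (intro divide_left_mono mult_pos_pos) (auto simp: N0)
  also have "\<dots> = 48 * s * real D / real d" using d s by (simp add: field_simps)
  finally have "measure_pmf.prob (column_pmf \<mu> n) {X. \<bar>\<Sum>r<n. X r * y r\<bar> \<le> s}
      \<le> 48 * s * real D / real d + 8 * exp (- (\<mu>\<^sup>2 / 2) * \<Lambda>)" by simp
  thus ?thesis using mem z(2) unfolding P_def by (intro bexI[of _ y]) (simp_all add: sum_y)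
qed

text \<open>
  Pigeonhole: as the level \<open>\<tau> V ^ m\<close> increases with \<open>m\<close>, the number of coordinates above it
  drops from at least \<open>\<kappa>\<close> to zero. Some level has at least \<open>\<kappa> / 2 ^ m\<close> coordinates
  above it while the next one has fewer than half as many, so that at least half of the former lie
  between the two levels.
\<close>

lemma exists_level_with_mass:
  fixes x :: "nat \<Rightarrow> real" and n :: nat
  defines "G \<equiv> \<lambda>\<tau>. card {r. r < n \<and> \<tau> \<le> \<bar>x r\<bar>}"
  assumes x: "\<And>r. r < n \<Longrightarrow> \<bar>x r\<bar> \<le> 1" and V: "V > 1" and \<tau>: "1 < \<tau> * V ^ M"
    and \<kappa>: "0 < \<kappa>" "\<kappa> \<le> real (G \<tau>)" 
  shows "\<exists>m<M. real (G (\<tau> * V ^ m * V)) \<le> \<kappa> \<and>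
           \<kappa> / 2 ^ M \<le> real (card {r. r < n \<and> \<tau> * V ^ m \<le> \<bar>x r\<bar> \<and> \<bar>x r\<bar> < \<tau> * V ^ m * V})"
proof -
  define P where "P m \<longleftrightarrow> \<kappa> / 2 ^ m \<le> real (G (\<tau> * V ^ m))" for m
  have "P 0" using \<kappa> by (simp add: P_def)
  moreover have "\<not> P M"
  proof -
    have "{r. r < n \<and> \<tau> * V ^ M \<le> \<bar>x r\<bar>} = {}" using x \<tau> by fastforce
    hence "G (\<tau> * V ^ M) = 0" unfolding G_def by (simp only: card.empty)
    moreover have "0 < \<kappa> / 2 ^ M" using \<kappa>(1) by (rule divide_pos_pos) simp
    ultimately show ?thesis unfolding P_def by simp
  qed
  ultimately obtain m where m: "m < M" "P m" "\<not> P (Suc m)"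
    by (metis (full_types) dec_induct le0 less_imp_le_nat not_less_eq_eq not_le)
  let ?b = "\<tau> * V ^ m"
  have tpos: "0 < \<tau>"
  proof (rule ccontr)
    assume "\<not> 0 < \<tau>"
    hence "\<tau> * V ^ M \<le> 0" using V by (intro mult_nonpos_nonneg) auto
    thus False using \<tau> by simp
  qed
  hence "0 \<le> ?b" using V by (intro mult_nonneg_nonneg zero_le_power) auto
  hence bV: "?b \<le> ?b * V" using mult_left_mono[of 1 V ?b] V by simp
  have up: "real (G (?b * V)) < \<kappa> / 2 ^ Suc m"
    using m(3) by (simp add: P_def mult_ac)
  have "{r. r < n \<and> ?b \<le> \<bar>x r\<bar>} = {r. r < n \<and> ?b \<le> \<bar>x r\<bar> \<and> \<bar>x r\<bar> < ?b * V} \<union> {r. r < n \<and> ?b * V \<le> \<bar>x r\<bar>}"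
    using bV by auto
  hence "G ?b \<le> card {r. r < n \<and> ?b \<le> \<bar>x r\<bar> \<and> \<bar>x r\<bar> < ?b * V} + G (?b * V)"
    unfolding G_def by (simp only: card_Un_le)
  moreover have "\<kappa> / 2 ^ m \<le> real (G ?b)" using m(2) by (simp add: P_def)
  moreover have "\<kappa> / 2 ^ M \<le> \<kappa> / 2 ^ Suc m"
    using m(1) \<kappa>(1) by (intro divide_left_mono power_increasing) auto
  moreover have "\<kappa> / 2 ^ m = \<kappa> / 2 ^ Suc m + \<kappa> / 2 ^ Suc m" by simp
  ultimately have "\<kappa> / 2 ^ M \<le> real (card {r. r < n \<and> ?b \<le> \<bar>x r\<bar> \<and> \<bar>x r\<bar> < ?b * V})"
    using up by linarith
  moreover have "\<kappa> / 2 ^ Suc m \<le> \<kappa> / 1"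
    using \<kappa>(1) by (intro divide_left_mono) (auto simp: one_le_power simp del: power_Suc)
  ultimately show ?thesis using up m(1) by (intro exI[of _ m]) simp
qed

section \<open>Union bounds\<close>

abbreviation columns_pmf :: "real \<Rightarrow> nat \<Rightarrow> (nat \<Rightarrow> nat \<Rightarrow> real) pmf" where
  "columns_pmf \<mu> n \<equiv> Pi_pmf {..<n} (\<lambda>_. 0) (\<lambda>_. column_pmf \<mu> n)"

lemma prob_sparse_kernel_le:
  assumes \<mu>: "0 \<le> \<mu>" "\<mu> \<le> 1" and n: "n > 0" and C: "C \<subseteq> {..<n}"
  shows "measure_pmf.prob (columns_pmf \<mu> n)
           {F. \<exists>w \<in> sparse_vectors n k R. (\<exists>r<n. 2 * t < \<bar>real_of_int (w r)\<bar>) \<and>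
                 (\<forall>j\<in>C. \<bar>\<Sum>r<n. F j r * of_int (w r)\<bar> \<le> t)}
           \<le> real ((n * (2 * R + 1)) ^ k) * (1 - \<mu> / 2) ^ card C"
proof -
  let ?P = "measure_pmf.prob (columns_pmf \<mu> n)"
  let ?W = "{w \<in> sparse_vectors n k R. \<exists>r<n. 2 * t < \<bar>real_of_int (w r)\<bar>}"
  let ?E = "\<lambda>w. {X. \<bar>\<Sum>r<n. X r * of_int (w r)\<bar> \<le> t}"
  have fin: "finite (sparse_vectors n k R)" and card: "card (sparse_vectors n k R) \<le> (n * (2 * R + 1)) ^ k"
    unfolding sparse_vectors_def by (rule card_sparse_le[OF n])+
  have "?P {F. \<exists>w \<in> sparse_vectors n k R. (\<exists>r<n. 2 * t < \<bar>real_of_int (w r)\<bar>) \<and>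
                 (\<forall>j\<in>C. \<bar>\<Sum>r<n. F j r * of_int (w r)\<bar> \<le> t)}
      \<le> ?P (\<Union>w\<in>?W. {F. \<forall>j\<in>C. F j \<in> ?E w})"
    by (intro measure_pmf.finite_measure_mono) auto
  also have "\<dots> \<le> (\<Sum>w\<in>?W. ?P {F. \<forall>j\<in>C. F j \<in> ?E w})"
    using fin by (intro measure_pmf.finite_measure_subadditive_finite) auto
  also have "\<dots> \<le> (\<Sum>w\<in>?W. (1 - \<mu> / 2) ^ card C)"
  proof (intro sum_mono)
    fix w assume "w \<in> ?W"
    then obtain r where r: "r < n" "2 * t < \<bar>real_of_int (w r)\<bar>" by blast
    have "?P {F. \<forall>j\<in>C. F j \<in> ?E w} = measure_pmf.prob (column_pmf \<mu> n) (?E w) ^ card C"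
      using C by (intro prob_columns_in) auto
    also have "\<dots> \<le> (1 - \<mu> / 2) ^ card C"
      unfolding column_pmf_def using r
      by (intro power_mono prob_linear_form_large_coefficient[OF \<mu>, of _ r]) auto
    finally show "?P {F. \<forall>j\<in>C. F j \<in> ?E w} \<le> (1 - \<mu> / 2) ^ card C" .
  qed
  also have "\<dots> = real (card ?W) * (1 - \<mu> / 2) ^ card C" by simp
  also have "\<dots> \<le> real ((n * (2 * R + 1)) ^ k) * (1 - \<mu> / 2) ^ card C"
  proof (intro mult_right_mono of_nat_mono)
    have "card ?W \<le> card (sparse_vectors n k R)" using fin by (intro card_mono) auto
    thus "card ?W \<le> (n * (2 * R + 1)) ^ k" using card by (rule order_trans)
  qed (use \<mu> in auto)
  finally show ?thesis .
qed

lemma prob_anticoncentrated_kernel_le: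
  assumes Y: "finite Y" and q: "q \<le> 1" "0 \<le> q" and C: "C \<subseteq> {..<n}"
  shows "measure_pmf.prob (columns_pmf \<mu> n)
           {F. \<exists>y\<in>Y. measure_pmf.prob (column_pmf \<mu> n) {X. \<bar>\<Sum>r<n. X r * y r\<bar> \<le> s} \<le> q \<and>
                 m \<le> card {j \<in> C. \<bar>\<Sum>r<n. F j r * y r\<bar> \<le> s}}
           \<le> real (card Y) * (2 ^ n * q ^ m)"
proof -
  let ?P = "measure_pmf.prob (columns_pmf \<mu> n)"
  let ?E = "\<lambda>y. {X. \<bar>\<Sum>r<n. X r * y r\<bar> \<le> s}"
  let ?Y = "{y \<in> Y. measure_pmf.prob (column_pmf \<mu> n) (?E y) \<le> q}"
  have "?P {F. \<exists>y\<in>Y. measure_pmf.prob (column_pmf \<mu> n) (?E y) \<le> q \<and>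
                 m \<le> card {j \<in> C. \<bar>\<Sum>r<n. F j r * y r\<bar> \<le> s}}
      \<le> ?P (\<Union>y\<in>?Y. {F. m \<le> card {j \<in> {..<n}. F j \<in> ?E y}})"
  proof (intro measure_pmf.finite_measure_mono subsetI)
    fix F assume "F \<in> {F. \<exists>y\<in>Y. measure_pmf.prob (column_pmf \<mu> n) (?E y) \<le> q \<and>
                 m \<le> card {j \<in> C. \<bar>\<Sum>r<n. F j r * y r\<bar> \<le> s}}"
    then obtain y where y: "y \<in> ?Y" "m \<le> card {j \<in> C. \<bar>\<Sum>r<n. F j r * y r\<bar> \<le> s}" by blast
    have "card {j \<in> C. \<bar>\<Sum>r<n. F j r * y r\<bar> \<le> s} \<le> card {j \<in> {..<n}. F j \<in> ?E y}"
      using C by (intro card_mono) auto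
    thus "F \<in> (\<Union>y\<in>?Y. {F. m \<le> card {j \<in> {..<n}. F j \<in> ?E y}})"
      using y by (intro UN_I[of y] CollectI) auto
  qed simp
  also have "\<dots> \<le> (\<Sum>y\<in>?Y. ?P {F. m \<le> card {j \<in> {..<n}. F j \<in> ?E y}})"
    using Y by (intro measure_pmf.finite_measure_subadditive_finite) auto
  also have "\<dots> \<le> (\<Sum>y\<in>?Y. 2 ^ n * q ^ m)"
  proof (intro sum_mono)
    fix y assume "y \<in> ?Y"
    hence "measure_pmf.prob (column_pmf \<mu> n) (?E y) \<le> q" by blast
    from prob_many_columns_in[OF _ this q(1), of "{..<n}" "\<lambda>_. 0" m]
    show "?P {F. m \<le> card {j \<in> {..<n}. F j \<in> ?E y}} \<le> 2 ^ n * q ^ m" by simp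
  qed
  also have "\<dots> = real (card ?Y) * (2 ^ n * q ^ m)" by simp
  also have "\<dots> \<le> real (card Y) * (2 ^ n * q ^ m)"
    using Y q by (intro mult_right_mono of_nat_mono card_mono) auto
  finally show ?thesis .
qed

section \<open>Reduction to rich normal vectors\<close>

definition max_normalized :: "nat \<Rightarrow> (nat \<Rightarrow> real) \<Rightarrow> bool" where
  "max_normalized n x \<longleftrightarrow> (\<forall>r<n. \<bar>x r\<bar> \<le> 1) \<and> (\<exists>r<n. \<bar>x r\<bar> = 1)"

definition rich_normal_event :: "real \<Rightarrow> nat \<Rightarrow> nat \<Rightarrow> real \<Rightarrow> real \<Rightarrow> (nat \<Rightarrow> nat \<Rightarrow> real) set" where
  "rich_normal_event \<mu> n i \<epsilon> p = {F. \<exists>x. max_normalized n x \<and> (\<forall>j\<in>{..<n} - {i}. (\<Sum>r<n. F j r * x r) = 0) \<and>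
      p \<le> measure_pmf.prob (column_pmf \<mu> n) {X. \<bar>\<Sum>r<n. X r * x r\<bar> \<le> \<epsilon>}}"

text \<open>
  If no rich vector is orthogonal to the columns other than \<open>C\<^sub>i\<close>, then any normal vector
  chosen as a function of these columns is poor, and \<open>\<bar>\<langle>C\<^sub>i, x\<rangle>\<bar> \<le> n \<epsilon>\<close> has conditional
  probability at most \<open>p\<close>.
\<close>

lemma prob_small_singular_value_le:
  assumes n: "n > 0" and p: "0 \<le> p"
    and T: "\<And>i. i < n \<Longrightarrow> measure_pmf.prob (columns_pmf \<mu> n) (rich_normal_event \<mu> n i (real n * \<epsilon>) p) \<le> T"
  shows "measure_pmf.prob (random_matrix_pmf \<mu> n) {M. smallest_singular_value n M \<le> \<epsilon>} \<le> real n * (p + T)"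
proof -
  let ?P = "measure_pmf.prob (columns_pmf \<mu> n)"
  let ?orth = "\<lambda>i F x. \<forall>j\<in>{..<n} - {i}. (\<Sum>r<n. F j r * x r) = (0::real)"
  let ?R = "\<lambda>i. rich_normal_event \<mu> n i (real n * \<epsilon>) p"
  define Q where "Q i = {F. (\<forall>x. max_normalized n x \<longrightarrow> ?orth i F x \<longrightarrow> \<bar>\<Sum>r<n. F i r * x r\<bar> \<le> real n * \<epsilon>) \<and> F \<notin> ?R i}" for i
  have Q: "?P (Q i) \<le> p" if i: "i < n" for i
  proof (rule prob_Pi_pmf_condition[of "{..<n}" i])
    fix f :: "nat \<Rightarrow> nat \<Rightarrow> real"
    obtain x where x: "max_normalized n x" "?orth i f x"
      using exists_orthogonal_vector[OF i, of f] by (auto simp: max_normalized_def)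
    have orth: "?orth i (f(i := y)) x" for y using x(2) by simp
    show "measure_pmf.prob (column_pmf \<mu> n) {y. f(i := y) \<in> Q i} \<le> p"
    proof (cases "p \<le> measure_pmf.prob (column_pmf \<mu> n) {X. \<bar>\<Sum>r<n. X r * x r\<bar> \<le> real n * \<epsilon>}")
      case True
      hence "f(i := y) \<in> ?R i" for y
        using x(1) orth unfolding rich_normal_event_def by blast
      hence "{y. f(i := y) \<in> Q i} = {}" by (auto simp: Q_def)
      thus ?thesis using p by simp
    next
      case False
      have "{y. f(i := y) \<in> Q i} \<subseteq> {X. \<bar>\<Sum>r<n. X r * x r\<bar> \<le> real n * \<epsilon>}"
      proof
        fix y assume "y \<in> {y. f(i := y) \<in> Q i}"
        hence "\<bar>\<Sum>r<n. (f(i := y)) i r * x r\<bar> \<le> real n * \<epsilon>"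
          using x(1) orth[of y] unfolding Q_def by blast
        thus "y \<in> {X. \<bar>\<Sum>r<n. X r * x r\<bar> \<le> real n * \<epsilon>}" by simp
      qed
      hence "measure_pmf.prob (column_pmf \<mu> n) {y. f(i := y) \<in> Q i}
          \<le> measure_pmf.prob (column_pmf \<mu> n) {X. \<bar>\<Sum>r<n. X r * x r\<bar> \<le> real n * \<epsilon>}"
        by (intro measure_pmf.finite_measure_mono) auto
      thus ?thesis using False by linarith
    qed
  qed (use i p in auto)
  have "measure_pmf.prob (random_matrix_pmf \<mu> n) {M. smallest_singular_value n M \<le> \<epsilon>}
      = ?P {F. smallest_singular_value n (mat n n (\<lambda>(r, j). F j r)) \<le> \<epsilon>}"
    by (simp add: random_matrix_pmf_columns vimage_def)
  also have "\<dots> \<le> ?P (\<Union>i<n. Q i \<union> ?R i)"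
  proof (intro measure_pmf.finite_measure_mono subsetI)
    fix F assume "F \<in> {F. smallest_singular_value n (mat n n (\<lambda>(r, j). F j r)) \<le> \<epsilon>}"
    hence "smallest_singular_value n (mat n n (\<lambda>(r, j). F j r)) \<le> \<epsilon>" by simp
    then obtain i where i: "i < n" "\<And>x. (\<forall>r<n. \<bar>x r\<bar> \<le> 1) \<Longrightarrow>
        (\<forall>j<n. j \<noteq> i \<longrightarrow> (\<Sum>r<n. F j r * x r) = 0) \<Longrightarrow> \<bar>\<Sum>r<n. F i r * x r\<bar> \<le> real n * \<epsilon>"
      using small_singular_value_imp_dependent_column[OF n] by blast
    hence "F \<in> Q i \<union> ?R i" by (auto simp: Q_def max_normalized_def)
    thus "F \<in> (\<Union>i<n. Q i \<union> ?R i)" using i(1) by blast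
  qed simp
  also have "\<dots> \<le> (\<Sum>i<n. ?P (Q i \<union> ?R i))"
    by (intro measure_pmf.finite_measure_subadditive_finite) auto
  also have "\<dots> \<le> (\<Sum>i<n. p + T)"
  proof (intro sum_mono)
    fix i assume "i \<in> {..<n}"
    hence i: "i < n" by simp
    have "?P (Q i \<union> ?R i) \<le> ?P (Q i) + ?P (?R i)"
      by (intro measure_Un_le) auto
    thus "?P (Q i \<union> ?R i) \<le> p + T" using Q[OF i] T[OF i] by linarith
  qed
  finally show ?thesis by simp
qed

section \<open>The structure of rich normal vectors\<close>

text \<open>
  Rounding \<open>n ^ 3 * x\<close> coordinatewise: the coordinates of \<open>x\<close> below \<open>n powr - 3\<close> become
  zero, the largest one becomes \<open>n ^ 3\<close> in absolute value, and the total error is at most \<open>n\<close>.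
\<close>

lemma sparse_kernel_vector:
  fixes F :: "nat \<Rightarrow> nat \<Rightarrow> real"
  assumes x: "max_normalized n x" and n: "n \<ge> 2"
    and F: "\<And>j r. \<bar>F j r\<bar> \<le> 1" and orth: "\<forall>j\<in>C. (\<Sum>r<n. F j r * x r) = 0"
    and few: "card {r. r < n \<and> 1 \<le> real n ^ 3 * \<bar>x r\<bar>} \<le> k"
  shows "\<exists>w \<in> sparse_vectors n k (n ^ 3). (\<exists>r<n. 2 * real n < \<bar>real_of_int (w r)\<bar>) \<and>
           (\<forall>j\<in>C. \<bar>\<Sum>r<n. F j r * of_int (w r)\<bar> \<le> real n)"
proof -
  let ?L = "real n ^ 3"
  define w where "w = restrict (\<lambda>r. if 1 \<le> ?L * \<bar>x r\<bar> then \<lfloor>?L * x r\<rfloor> else 0) {..<n}"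
  have x1: "\<bar>x r\<bar> \<le> 1" if "r < n" for r using x that by (auto simp: max_normalized_def)
  have w_err: "\<bar>of_int (w r) - ?L * x r\<bar> \<le> 1" if r: "r < n" for r
  proof (cases "1 \<le> ?L * \<bar>x r\<bar>")
    case True
    thus ?thesis using r by (simp add: w_def) linarith
  next
    case False
    hence "\<bar>?L * x r\<bar> \<le> 1" by (simp add: abs_mult)
    thus ?thesis using r False by (simp add: w_def)
  qed
  have "w r \<in> {- int (n ^ 3)..int (n ^ 3)}" if r: "r < n" for r
  proof -
    have "\<bar>?L * x r\<bar> \<le> ?L * 1" using x1[OF r] by (simp add: abs_mult mult_left_le)
    hence "- ?L \<le> ?L * x r" "?L * x r \<le> ?L" by (simp_all add: abs_le_iff)
    hence "- int (n ^ 3) \<le> \<lfloor>?L * x r\<rfloor>" "\<lfloor>?L * x r\<rfloor> \<le> int (n ^ 3)"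
      by (simp_all add: le_floor_iff floor_le_iff)
    thus ?thesis using r by (simp add: w_def)
  qed
  moreover have "card {r. r < n \<and> w r \<noteq> 0} \<le> card {r. r < n \<and> 1 \<le> ?L * \<bar>x r\<bar>}"
    by (intro card_mono) (auto simp: w_def)
  ultimately have mem: "w \<in> sparse_vectors n k (n ^ 3)"
    using few by (auto simp: sparse_vectors_def PiE_iff w_def)
  obtain r0 where r0: "r0 < n" "\<bar>x r0\<bar> = 1" using x by (auto simp: max_normalized_def)
  have "2 * real n < \<bar>real_of_int (w r0)\<bar>"
  proof -
    have "2 ^ 2 \<le> real n ^ 2" using n by (intro power_mono) auto
    hence "real n * 4 \<le> real n * real n ^ 2" by (intro mult_left_mono) auto
    hence "4 * real n \<le> ?L" by (simp add: power2_eq_square power3_eq_cube mult_ac)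
    moreover have "\<bar>?L * x r0\<bar> = ?L" using r0(2) by (simp add: abs_mult)
    ultimately show ?thesis using w_err[OF r0(1)] n by linarith
  qed
  moreover have "\<bar>\<Sum>r<n. F j r * of_int (w r)\<bar> \<le> real n" if j: "j \<in> C" for j
  proof -
    have "(\<Sum>r<n. F j r * of_int (w r)) = (\<Sum>r<n. F j r * (of_int (w r) - ?L * x r)) + ?L * (\<Sum>r<n. F j r * x r)"
      by (simp add: sum_distrib_left sum.distrib[symmetric] algebra_simps)
    also have "\<dots> = (\<Sum>r<n. F j r * (of_int (w r) - ?L * x r))" using orth j by simp
    finally have "\<bar>\<Sum>r<n. F j r * of_int (w r)\<bar> \<le> (\<Sum>r<n. \<bar>F j r * (of_int (w r) - ?L * x r)\<bar>)"
      by (simp add: sum_abs)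
    also have "\<dots> \<le> (\<Sum>r<n. 1)"
      using F w_err by (intro sum_mono) (auto simp: abs_mult intro!: mult_le_one)
    finally show ?thesis by simp
  qed
  ultimately show ?thesis using mem r0(1) by blast
qed

text \<open>
  The inequalities between powers of \<open>n\<close> that the construction consumes, with
  \<open>V = \<Lambda> = n powr (1/40)\<close>, the lattice multiples restricted to \<open>d < n ^ a\<close>, the window length
  \<open>D = \<lceil>n powr (11/20)\<rceil>\<close>, the precision \<open>\<delta> = n powr (- 1/4)\<close>, the width \<open>s = n powr (11/40)\<close> of the
  final interval and \<open>\<kappa> = n powr (39/40)\<close>. In order, the conjuncts after the first say: \<open>121\<close> levels
  reach from \<open>n powr - 3\<close> beyond \<open>1\<close>; a vector of concentration \<open>p\<close> is rich enough to have a lattice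
  multiple; such a multiple cannot be one of the trivial small ones; \<open>\<delta>\<close> is coarse enough for the
  fine part to be counted; rounding does not spoil the Fourier estimate; \<open>s\<close> is small compared with
  the multiple; the exceptional coordinates are polynomially bounded; roundings are
  anticoncentrated at the expected rate; few columns are lost in the mean square estimate.
\<close>

definition sufficiently_large :: "real \<Rightarrow> nat \<Rightarrow> real \<Rightarrow> nat \<Rightarrow> bool" where
  "sufficiently_large \<mu> a p n \<longleftrightarrow>
     n \<ge> 2 \<and>
     1 < 1 / real n ^ 3 * (real n powr (1/40)) ^ 121 \<and>
     8 * (real n powr (11/20) + 1) / real n ^ a + 8 * exp (- (\<mu>\<^sup>2 / 2) * real n powr (1/40)) < p \<and>
     12 * real n powr (1/40) < (real n powr (11/20) / real n)\<^sup>2 * (real n powr (39/40) / 2 ^ 121) \<and>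
     24 * real n powr (1/40) \<le> real n * (real n powr (- 1/4))\<^sup>2 \<and>
     real n * (real n powr (- 1/4))\<^sup>2 \<le> (real n powr (11/40))\<^sup>2 \<and>
     3 * real n powr (11/40) \<le> real n powr (11/20) \<and>
     real n ^ a * real n ^ 2 / real n powr (- 1/4) + 1 \<le> real n ^ (a + 3) \<and>
     48 * real n powr (11/40) * (real n powr (11/20) + 1) + real n ^ a * (8 * exp (- (\<mu>\<^sup>2 / 2) * real n powr (1/40)))
       \<le> 98 * real n powr (33/40) \<and>
     real n * real n * (real n powr (- 1/4))\<^sup>2 / (real n powr (11/40))\<^sup>2 \<le> real n powr (39/40)"

text \<open>
  The first alternative is the sparse case and the second one the structured case of the
  introduction. The condition \<open>1 / 2 < h d V\<close>, for \<open>h = 1 / n\<close>, bounds the number of integers between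
  \<open>- h d V - 1\<close> and \<open>h d V + 1\<close> by a multiple of \<open>h d V\<close>, so that the count of structured vectors
  scales with \<open>d\<close> exactly as the reciprocal of their concentration probability does.
\<close>

lemma rich_normal_dichotomy:
  fixes F :: "nat \<Rightarrow> nat \<Rightarrow> real" and n a i :: nat and p \<epsilon> \<mu> :: real
  defines "C \<equiv> {..<n} - {i}" and "k \<equiv> nat \<lfloor>real n powr (39/40)\<rfloor>"
  assumes \<mu>: "0 \<le> \<mu>" "\<mu> \<le> 1" and i: "i < n" and F: "\<And>j r. \<bar>F j r\<bar> \<le> 1"
    and x: "max_normalized n x" and orth: "\<forall>j\<in>C. (\<Sum>r<n. F j r * x r) = 0"
    and rich: "p \<le> measure_pmf.prob (column_pmf \<mu> n) {X. \<bar>\<Sum>r<n. X r * x r\<bar> \<le> \<epsilon>}"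
    and \<epsilon>: "\<epsilon> * real n ^ 3 \<le> real n / (3 * real n ^ a)"
    and large: "sufficiently_large \<mu> a p n"
  shows "(\<exists>w \<in> sparse_vectors n k (n ^ 3). (\<exists>r<n. 2 * real n < \<bar>real_of_int (w r)\<bar>) \<and>
            (\<forall>j\<in>C. \<bar>\<Sum>r<n. F j r * of_int (w r)\<bar> \<le> real n)) \<or>
         (\<exists>d \<in> {1..<n ^ a}. 1 / 2 < 1 / real n * real d * real n powr (1/40) \<and>
            (\<exists>y \<in> structured_vectors n (real n powr (- 1/4))
                (nat \<lfloor>1 / real n * real d * real n powr (1/40)\<rfloor> + 1) k (n ^ (a + 3)) (3 * n).
              measure_pmf.prob (column_pmf \<mu> n) {X. \<bar>\<Sum>r<n. X r * y r\<bar> \<le> real n powr (11/40)}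
                \<le> 98 * real n powr (33/40) / real d \<and>
              n - 1 - nat \<lfloor>real n powr (39/40)\<rfloor> \<le> card {j \<in> C. \<bar>\<Sum>r<n. F j r * y r\<bar> \<le> real n powr (11/40)}))"
    (is "?sparse \<or> ?struct")
proof (cases "real (card {r. r < n \<and> 1 \<le> real n ^ 3 * \<bar>x r\<bar>}) < real n powr (39/40)")
  case True
  hence "card {r. r < n \<and> 1 \<le> real n ^ 3 * \<bar>x r\<bar>} \<le> k" unfolding k_def by linarith
  hence ?sparse
    using large by (intro sparse_kernel_vector[OF x _ F orth]) (auto simp: sufficiently_large_def)
  thus ?thesis ..
next
  case many: False
  define V where "V = real n powr (1/40)"
  define \<delta> where "\<delta> = real n powr (- 1/4)"
  define s where "s = real n powr (11/40)"
  define D where "D = nat \<lceil>real n powr (11/20)\<rceil>"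
  define h where "h = 1 / real n"
  define \<kappa> where "\<kappa> = real n powr (39/40)"
  have n: "n \<ge> 2" using large by (simp add: sufficiently_large_def)
  have n0: "0 < real n" using n by simp
  have large':
    "1 < 1 / real n ^ 3 * V ^ 121"
    "8 * (real n powr (11/20) + 1) / real n ^ a + 8 * exp (- (\<mu>\<^sup>2 / 2) * V) < p"
    "12 * V < (real n powr (11/20) / real n)\<^sup>2 * (\<kappa> / 2 ^ 121)"
    "24 * V \<le> real n * \<delta>\<^sup>2" "real n * \<delta>\<^sup>2 \<le> s\<^sup>2" "3 * s \<le> real n powr (11/20)"
    "real n ^ a * real n ^ 2 / \<delta> + 1 \<le> real n ^ (a + 3)"
    "48 * s * (real n powr (11/20) + 1) + real n ^ a * (8 * exp (- (\<mu>\<^sup>2 / 2) * V)) \<le> 98 * real n powr (33/40)"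
    "real n * real n * \<delta>\<^sup>2 / s\<^sup>2 \<le> real n powr (39/40)"
    using large unfolding sufficiently_large_def V_def \<delta>_def s_def \<kappa>_def by blast+
  have pos: "0 < V" "0 < \<delta>" "0 < s" "0 < h" "0 < \<kappa>"
    using n0 by (auto simp: V_def \<delta>_def s_def h_def \<kappa>_def)
  have V1: "1 < V" using n unfolding V_def by (intro gr_one_powr) auto
  have s1: "1 \<le> s" using n unfolding s_def by (intro ge_one_powr_ge_zero) auto
  have D: "real n powr (11/20) \<le> real D" "real D \<le> real n powr (11/20) + 1"
    using powr_ge_zero[of "real n" "11/20"] unfolding D_def by linarith+
  have x1: "\<And>r. r < n \<Longrightarrow> \<bar>x r\<bar> \<le> 1" using x by (simp add: max_normalized_def)
  have lev: "1 / real n ^ 3 \<le> \<bar>x r\<bar> \<longleftrightarrow> 1 \<le> real n ^ 3 * \<bar>x r\<bar>" for r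
    using n0 by (simp add: field_simps)
  have "\<kappa> \<le> real (card {r. r < n \<and> 1 / real n ^ 3 \<le> \<bar>x r\<bar>})"
    unfolding lev using many by (simp add: \<kappa>_def)
  from exists_level_with_mass[OF x1 V1 large'(1) pos(5) this]
  obtain m where m:
    "real (card {r. r < n \<and> 1 / real n ^ 3 * V ^ m * V \<le> \<bar>x r\<bar>}) \<le> \<kappa>"
    "\<kappa> / 2 ^ 121 \<le> real (card {r. r < n \<and> 1 / real n ^ 3 * V ^ m \<le> \<bar>x r\<bar> \<and> \<bar>x r\<bar> < 1 / real n ^ 3 * V ^ m * V})"
    by blast
  define b where "b = 1 / real n ^ 3 * V ^ m"
  have "1 \<le> V ^ m" using V1 by (intro one_le_power) simp
  hence b_ge: "1 / real n ^ 3 \<le> b" unfolding b_def using n0 by (simp add: field_simps)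
  have b: "0 < b" by (rule less_le_trans[OF _ b_ge]) (use n0 in simp)
  define v where "v r = x r / b" for r
  define J where "J = {r. r < n \<and> \<bar>x r\<bar> < b * V}"
  define K where "K = {r. r < n \<and> b \<le> \<bar>x r\<bar> \<and> \<bar>x r\<bar> < b * V}"
  have J: "J \<subseteq> {..<n}" by (auto simp: J_def)
  have "{..<n} - J = {r. r < n \<and> b * V \<le> \<bar>x r\<bar>}" by (auto simp: J_def)
  hence J': "card ({..<n} - J) \<le> k"
    using m(1) unfolding k_def b_def[symmetric] \<kappa>_def by (simp add: le_nat_floor)
  have K: "K \<subseteq> J" "\<kappa> / 2 ^ 121 \<le> real (card K)"
    using m(2) unfolding K_def J_def b_def[symmetric] by auto
  have vV: "\<bar>v r\<bar> \<le> V" if "r \<in> J" for r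
    using that b by (auto simp: v_def J_def field_simps)
  have v1: "1 \<le> \<bar>v r\<bar>" if "r \<in> K" for r
    using that b by (auto simp: v_def K_def field_simps)
  have inv_b: "1 / b \<le> real n ^ 3"
    using b_ge b n0 by (simp add: field_simps)
  have vU: "\<bar>v r\<bar> \<le> real n ^ 3" if "r < n" for r
  proof -
    have "\<bar>v r\<bar> \<le> 1 / b" using x1[OF that] b by (simp add: v_def divide_right_mono)
    thus ?thesis using inv_b by linarith
  qed
  have orth_v: "(\<Sum>r<n. F j r * v r) = 0" if "j \<in> C" for j
    using orth that by (simp add: v_def flip: sum_divide_distrib)
  define N where "N = n ^ a"
  have N: "N > 0" using n by (simp add: N_def)
  have conc: "p \<le> measure_pmf.prob (column_pmf \<mu> n) {X. \<bar>\<Sum>r<n. X r * v r\<bar> \<le> 1 / (3 * h * real N)}"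
  proof (rule order_trans[OF rich], intro measure_pmf.finite_measure_mono subsetI)
    fix X assume "X \<in> {X. \<bar>\<Sum>r<n. X r * x r\<bar> \<le> \<epsilon>}"
    hence X: "\<bar>\<Sum>r<n. X r * x r\<bar> \<le> \<epsilon>" by simp
    have "\<bar>\<Sum>r<n. X r * v r\<bar> = \<bar>\<Sum>r<n. X r * x r\<bar> * (1 / b)"
      using b by (simp add: v_def abs_mult flip: sum_divide_distrib)
    also have "\<dots> \<le> \<epsilon> * real n ^ 3"
      using X inv_b b by (intro mult_mono) auto
    also have "\<dots> \<le> 1 / (3 * h * real N)" using \<epsilon> n0 by (simp add: h_def N_def)
    finally show "X \<in> {X. \<bar>\<Sum>r<n. X r * v r\<bar> \<le> 1 / (3 * h * real N)}" by simp
  qed simp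
  have "8 * real D / real N \<le> 8 * (real n powr (11/20) + 1) / real n ^ a"
    using D(2) by (simp add: N_def divide_right_mono)
  hence "8 * real D / real N + 8 * exp (- (\<mu>\<^sup>2 / 2) * V)
      < measure_pmf.prob (column_pmf \<mu> n) {X. \<bar>\<Sum>r<n. X r * v r\<bar> \<le> 1 / (3 * h * real N)}"
    using large'(2) conc by linarith
  from concentration_imp_near_lattice_multiple[OF \<mu> J N pos(4) this]
  obtain d0 where d0: "D \<le> d0" "d0 < N" "lattice_dist2 J (\<lambda>i. h * real d0 * v i) \<le> 4 * V" by blast
  \<comment> \<open>The least multiple is needed, not just some multiple: the absence of smaller ones
    is what makes the rounding anticoncentrated.\<close>
  define near where "near d \<longleftrightarrow> D \<le> d \<and> lattice_dist2 J (\<lambda>i. h * real d * v i) \<le> 12 * V" for d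
  define d where "d = (LEAST d. near d)"
  have near0: "near d0" using d0 V1 by (simp add: near_def)
  have near: "near d" unfolding d_def by (rule LeastI[of near, OF near0])
  have d: "D \<le> d" "lattice_dist2 J (\<lambda>i. h * real d * v i) \<le> 12 * V"
    using near by (simp_all add: near_def)
  have dN: "d < N" using Least_le[of near, OF near0] d0(2) by (simp add: d_def)
  have gap: "12 * V < lattice_dist2 J (\<lambda>i. h * real j * v i)" if "D \<le> j" "j < d" for j
    using not_less_Least[of j near] that by (simp add: near_def d_def)
  have dD: "real n powr (11/20) \<le> real d" using D(1) d(1) by linarith
  have d3: "3 * s \<le> real d" using large'(6) dD by linarith
  have d0': "0 < real d" using d3 s1 by linarith
  \<comment> \<open>Otherwise the multiple would be so small that the coordinates in \<open>K\<close> keep it away from the lattice.\<close>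
  have far: "1 / 2 < h * real d * V"
  proof (rule ccontr)
    assume "\<not> ?thesis"
    hence le: "h * real d * V \<le> 1 / 2" by simp
    have hd: "0 \<le> h * real d" using pos(4) by (intro mult_nonneg_nonneg) auto
    have finJ: "finite J" using J by (rule finite_subset) simp
    have KV: "\<bar>v r\<bar> \<le> V" if "r \<in> K" for r using vV K(1) that by blast
    have "(h * real d)\<^sup>2 * real (card K) \<le> 12 * V"
      using near_lattice_multiple_lower_bound[where v = v, OF finJ K(1) v1 KV hd le] d(2) by linarith
    moreover have "(real n powr (11/20) / real n)\<^sup>2 * (\<kappa> / 2 ^ 121) \<le> (h * real d)\<^sup>2 * real (card K)"
      using dD n0 K(2) pos(5) by (intro mult_mono power_mono) (auto simp: h_def divide_right_mono)
    ultimately show False using large'(3) by linarith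
  qed
  have finC: "finite C" by (simp add: C_def)
  have U: "h * real d * real n ^ 3 / \<delta> + 1 \<le> real (n ^ (a + 3))"
  proof -
    have "h * real d * real n ^ 3 = real d * real n ^ 2"
      using n0 by (simp add: h_def power2_eq_square power3_eq_cube)
    also have "\<dots> \<le> real n ^ a * real n ^ 2"
      using dN by (intro mult_right_mono) (simp_all add: N_def flip: of_nat_power)
    finally have "h * real d * real n ^ 3 / \<delta> \<le> real n ^ a * real n ^ 2 / \<delta>"
      using pos(2) by (intro divide_right_mono) auto
    thus ?thesis using large'(7) by simp
  qed
  have "1 \<le> V" using V1 by simp
  obtain y where y: "y \<in> structured_vectors n \<delta> (nat \<lfloor>h * real d * V\<rfloor> + 1) k (n ^ (a + 3)) (3 * n)"
      "measure_pmf.prob (column_pmf \<mu> n) {X. \<bar>\<Sum>r<n. X r * y r\<bar> \<le> s}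
         \<le> 48 * s * real D / real d + 8 * exp (- (\<mu>\<^sup>2 / 2) * V)"
      "(\<Sum>j\<in>C. (\<Sum>r<n. F j r * y r)\<^sup>2) \<le> real (card C) * real n * \<delta>\<^sup>2"
    using structured_approximation[where F = F and D = D, OF \<mu> finC F orth_v J J' vV vU U pos(2) large'(4) pos(4) s1 large'(5) d3 d(2) \<open>1 \<le> V\<close> gap]
    by blast
  have prob_y: "measure_pmf.prob (column_pmf \<mu> n) {X. \<bar>\<Sum>r<n. X r * y r\<bar> \<le> s} \<le> 98 * real n powr (33/40) / real d"
  proof -
    let ?e = "8 * exp (- (\<mu>\<^sup>2 / 2) * V)"
    have "real d * ?e \<le> real n ^ a * ?e"
      using dN by (intro mult_right_mono) (simp_all add: N_def flip: of_nat_power)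
    moreover have "48 * s * real D \<le> 48 * s * (real n powr (11/20) + 1)"
      using D(2) s1 by (intro mult_left_mono) auto
    ultimately have "48 * s * real D + real d * ?e \<le> 98 * real n powr (33/40)"
      using large'(8) by linarith
    hence "(48 * s * real D + real d * ?e) / real d \<le> 98 * real n powr (33/40) / real d"
      by (intro divide_right_mono) auto
    thus ?thesis using y(2) d0' by (simp add: add_divide_distrib)
  qed
  have "n - 1 - nat \<lfloor>real n powr (39/40)\<rfloor> \<le> card {j \<in> C. \<bar>\<Sum>r<n. F j r * y r\<bar> \<le> s}"
  proof -
    \<comment> \<open>Markov: the columns with a large error are few because the sum of all squared errors is small.\<close>
    let ?B = "{j \<in> C. \<not> \<bar>\<Sum>r<n. F j r * y r\<bar> \<le> s}"
    have "real (card ?B) * s\<^sup>2 = (\<Sum>j\<in>?B. s\<^sup>2)" by simp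
    also have "\<dots> \<le> (\<Sum>j\<in>?B. (\<Sum>r<n. F j r * y r)\<^sup>2)"
      using s1 by (intro sum_mono) (auto simp flip: abs_le_square_iff)
    also have "\<dots> \<le> (\<Sum>j\<in>C. (\<Sum>r<n. F j r * y r)\<^sup>2)"
      using finC by (intro sum_mono2) auto
    also have "\<dots> \<le> real (card C) * real n * \<delta>\<^sup>2" by (rule y(3))
    also have "\<dots> \<le> real n * real n * \<delta>\<^sup>2"
      using card_mono[of "{..<n}" C] by (intro mult_right_mono) (auto simp: C_def)
    finally have "real (card ?B) \<le> real n * real n * \<delta>\<^sup>2 / s\<^sup>2"
      using pos(3) by (simp add: field_simps)
    hence "card ?B \<le> nat \<lfloor>real n powr (39/40)\<rfloor>"
      using large'(9) by (intro le_nat_floor) linarith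
    moreover have "card {j \<in> C. \<bar>\<Sum>r<n. F j r * y r\<bar> \<le> s} + card ?B = card C"
      using finC by (subst card_Un_disjoint[symmetric]) (auto intro: arg_cong[of _ _ card])
    moreover have "card C = n - 1" using i by (simp add: C_def)
    ultimately show ?thesis by linarith
  qed
  hence "\<exists>y \<in> structured_vectors n \<delta> (nat \<lfloor>h * real d * V\<rfloor> + 1) k (n ^ (a + 3)) (3 * n).
      measure_pmf.prob (column_pmf \<mu> n) {X. \<bar>\<Sum>r<n. X r * y r\<bar> \<le> s} \<le> 98 * real n powr (33/40) / real d \<and>
      n - 1 - nat \<lfloor>real n powr (39/40)\<rfloor> \<le> card {j \<in> C. \<bar>\<Sum>r<n. F j r * y r\<bar> \<le> s}"
    using y(1) prob_y by blast
  moreover have "d \<in> {1..<n ^ a}" using dN d0' by (simp add: N_def)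
  ultimately have ?struct
    using far unfolding h_def V_def \<delta>_def s_def by (intro bexI[of _ d] conjI)
  thus ?thesis ..
qed

section \<open>Probability of a rich normal vector\<close>

text \<open>
  The factor \<open>d\<close> in the number of values of each coordinate cancels against the factor \<open>1 / d\<close> in
  the probability for each column, and what remains is \<open>n powr (- 3/20)\<close>, up to a constant, for each of the \<open>n\<close> pairs of a
  coordinate and a column. The \<open>e + 1\<close> columns that are not available for this are paid for with
  \<open>n ^ a\<close> each, as \<open>1 / q \<le> n ^ a\<close>.
\<close>

lemma card_structured_vectors_times_power_le:
  fixes d n a k :: nat
  defines "q \<equiv> 98 * real n powr (33/40) / real d"
    and "H \<equiv> 1 / real n * real d * real n powr (1/40)"
    and "e \<equiv> nat \<lfloor>real n powr (39/40)\<rfloor>"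
  assumes n: "n > 0" and d: "1 \<le> d" "d < n ^ a" and H: "1 / 2 < H" and q: "q \<le> 1"
  shows "real (card (structured_vectors n \<delta> (nat \<lfloor>H\<rfloor> + 1) k R (3 * n))) * (2 ^ n * q ^ (n - 1 - e))
    \<le> (37632 * real n powr (- 3/20)) ^ n * real (n ^ a) ^ (e + 1) * real ((n * (2 * R + 1)) ^ k)"
proof -
  let ?S = "real ((n * (2 * R + 1)) ^ k)"
  let ?Y = "structured_vectors n \<delta> (nat \<lfloor>H\<rfloor> + 1) k R (3 * n)"
  have n0: "0 < real n" using n by simp
  have q0: "0 < q" unfolding q_def using n0 d by simp
  have "real (2 * (nat \<lfloor>H\<rfloor> + 1) + 1) \<le> 8 * H"
  proof -
    have "real (nat \<lfloor>H\<rfloor>) \<le> H" using H by (intro of_nat_floor) simp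
    moreover have "real (2 * (nat \<lfloor>H\<rfloor> + 1) + 1) = 2 * real (nat \<lfloor>H\<rfloor>) + 3"
      by simp
    ultimately show ?thesis using H by linarith
  qed
  hence 1: "real (2 * (nat \<lfloor>H\<rfloor> + 1) + 1) ^ n \<le> (8 * H) ^ n"
    by (intro power_mono) auto
  have "real (card ?Y) \<le> real ((2 * (nat \<lfloor>H\<rfloor> + 1) + 1) ^ n * (n * (2 * R + 1)) ^ k * (2 ^ (3 * n) * 3 ^ n))"
    using structured_vectors_card(2)[OF n, of \<delta> "nat \<lfloor>H\<rfloor> + 1" k R "3 * n"] by (simp only: of_nat_le_iff)
  also have "\<dots> = real (2 * (nat \<lfloor>H\<rfloor> + 1) + 1) ^ n * ?S * 24 ^ n"
    by (simp add: power_mult flip: power_mult_distrib)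
  also have "\<dots> \<le> (8 * H) ^ n * ?S * 24 ^ n"
    using 1 by (intro mult_right_mono) auto
  finally have card: "real (card ?Y) \<le> (8 * H) ^ n * ?S * 24 ^ n" .
  have power: "q ^ (n - 1 - e) \<le> q ^ n * real (n ^ a) ^ (e + 1)"
  proof -
    have "1 \<le> q * real (n ^ a)"
    proof -
      have "1 \<le> real n powr (33/40)" using n by (intro ge_one_powr_ge_zero) auto
      moreover have "1 \<le> real (n ^ a) / real d" using d by (simp flip: of_nat_power)
      ultimately have "1 * 1 \<le> (98 * real n powr (33/40)) * (real (n ^ a) / real d)"
        by (intro mult_mono) auto
      thus ?thesis by (simp add: q_def)
    qed
    hence "q ^ (n - 1 - e) * 1 \<le> q ^ (n - 1 - e) * (q * real (n ^ a)) ^ (e + 1)"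
      using q0 by (intro mult_left_mono one_le_power) auto
    also have "\<dots> = q ^ ((n - 1 - e) + (e + 1)) * real (n ^ a) ^ (e + 1)"
      by (simp only: power_mult_distrib power_add[of q "n - 1 - e"] mult.assoc)
    also have "\<dots> \<le> q ^ n * real (n ^ a) ^ (e + 1)"
      using q q0 by (intro mult_right_mono power_decreasing) auto
    finally show ?thesis by simp
  qed
  have Hq: "H * q = 98 * real n powr (- 3/20)"
  proof -
    have "H * q = 98 * (real n powr (1/40) * real n powr (33/40) / real n powr 1)"
      using d n0 by (simp add: H_def q_def)
    also have "real n powr (1/40) * real n powr (33/40) / real n powr 1 = real n powr (1/40 + 33/40 - 1)"
      by (simp only: powr_add powr_diff)
    finally show ?thesis by simp
  qed
  have "real (card ?Y) * (2 ^ n * q ^ (n - 1 - e))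
      \<le> ((8 * H) ^ n * ?S * 24 ^ n) * (2 ^ n * (q ^ n * real (n ^ a) ^ (e + 1)))"
    using q0 H by (intro mult_mono card mult_left_mono power) auto
  also have "\<dots> = (8 * H * 24 * 2 * q) ^ n * real (n ^ a) ^ (e + 1) * ?S"
    by (simp only: power_mult_distrib mult_ac)
  also have "8 * H * 24 * 2 * q = 384 * (H * q)" by simp
  also have "\<dots> = 37632 * real n powr (- 3/20)" by (simp add: Hq)
  finally show ?thesis .
qed

lemma prob_rich_normal_le:
  fixes n a i :: nat and p \<epsilon> \<mu> :: real
  defines "e \<equiv> nat \<lfloor>real n powr (39/40)\<rfloor>"
  assumes \<mu>: "0 \<le> \<mu>" "\<mu> \<le> 1" and i: "i < n"
    and \<epsilon>: "\<epsilon> * real n ^ 3 \<le> real n / (3 * real n ^ a)"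
    and large: "sufficiently_large \<mu> a p n" "196 * real n powr (33/40) \<le> real n powr (39/40)"
  shows "measure_pmf.prob (columns_pmf \<mu> n) (rich_normal_event \<mu> n i \<epsilon> p)
    \<le> real ((n * (2 * n ^ 3 + 1)) ^ e) * (1 - \<mu> / 2) ^ (n - 1)
      + real (n ^ a) * ((37632 * real n powr (- 3/20)) ^ n * real (n ^ a) ^ (e + 1)
          * real ((n * (2 * n ^ (a + 3) + 1)) ^ e))"
proof -
  let ?P = "measure_pmf.prob (columns_pmf \<mu> n)"
  let ?C = "{..<n} - {i}"
  let ?H = "\<lambda>d::nat. 1 / real n * real d * real n powr (1/40)"
  let ?Y = "\<lambda>d. structured_vectors n (real n powr (- 1/4)) (nat \<lfloor>?H d\<rfloor> + 1) e (n ^ (a + 3)) (3 * n)"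
  let ?s = "real n powr (11/40)"
  let ?q = "\<lambda>d::nat. 98 * real n powr (33/40) / real d"
  let ?T = "(37632 * real n powr (- 3/20)) ^ n * real (n ^ a) ^ (e + 1) * real ((n * (2 * n ^ (a + 3) + 1)) ^ e)"
  define E1 where "E1 = {F. \<exists>w \<in> sparse_vectors n e (n ^ 3). (\<exists>r<n. 2 * real n < \<bar>real_of_int (w r)\<bar>) \<and>
            (\<forall>j\<in>?C. \<bar>\<Sum>r<n. F j r * of_int (w r)\<bar> \<le> real n)}"
  define E2 where "E2 d = {F. \<exists>y\<in>?Y d. measure_pmf.prob (column_pmf \<mu> n) {X. \<bar>\<Sum>r<n. X r * y r\<bar> \<le> ?s} \<le> ?q d \<and>
                 n - 1 - e \<le> card {j \<in> ?C. \<bar>\<Sum>r<n. F j r * y r\<bar> \<le> ?s}}" for d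
  define I where "I = {d \<in> {1..<n ^ a}. 1 / 2 < ?H d}"
  have n: "n > 0" using i by simp
  have "F \<in> E1 \<union> (\<Union>d\<in>I. E2 d)"
    if F: "F \<in> set_pmf (columns_pmf \<mu> n)" and R: "F \<in> rich_normal_event \<mu> n i \<epsilon> p" for F
  proof -
    obtain x where x: "max_normalized n x" "\<forall>j\<in>?C. (\<Sum>r<n. F j r * x r) = 0"
      "p \<le> measure_pmf.prob (column_pmf \<mu> n) {X. \<bar>\<Sum>r<n. X r * x r\<bar> \<le> \<epsilon>}"
      using R unfolding rich_normal_event_def by blast
    have "\<bar>F j r\<bar> \<le> 1" for j r using abs_entry_le_1[OF F] by simp
    from rich_normal_dichotomy[OF \<mu> i this x \<epsilon> large(1)] show ?thesis
      unfolding E1_def E2_def I_def e_def by blast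
  qed
  hence "?P (rich_normal_event \<mu> n i \<epsilon> p) \<le> ?P (E1 \<union> (\<Union>d\<in>I. E2 d))"
    by (intro measure_pmf.finite_measure_mono_AE) (auto simp: AE_measure_pmf_iff)
  also have "\<dots> \<le> ?P E1 + ?P (\<Union>d\<in>I. E2 d)"
    by (intro measure_Un_le) auto
  also have "?P E1 \<le> real ((n * (2 * n ^ 3 + 1)) ^ e) * (1 - \<mu> / 2) ^ (n - 1)"
    unfolding E1_def using prob_sparse_kernel_le[OF \<mu> n, of ?C e "n ^ 3" "real n"] i by simp
  also have "?P (\<Union>d\<in>I. E2 d) \<le> (\<Sum>d\<in>I. ?P (E2 d))"
    by (intro measure_pmf.finite_measure_subadditive_finite) (auto simp: I_def)
  also have "\<dots> \<le> (\<Sum>d\<in>I. ?T)"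
  proof (intro sum_mono)
    fix d assume "d \<in> I"
    hence d: "1 \<le> d" "d < n ^ a" "1 / 2 < ?H d" by (auto simp: I_def)
    have q: "?q d \<le> 1"
    proof -
      have "real n powr (39/40) = real n powr 1 / real n powr (1/40)"
        using powr_diff[of "real n" 1 "1/40"] by simp
      moreover have "real n / real n powr (1/40) < 2 * real d"
        using d(3) n by (simp add: field_simps)
      ultimately have "98 * real n powr (33/40) \<le> real d"
        using large(2) by simp
      thus ?thesis using d(1) by simp
    qed
    have "?P (E2 d) \<le> real (card (?Y d)) * (2 ^ n * ?q d ^ (n - 1 - e))"
      unfolding E2_def using q
      by (intro prob_anticoncentrated_kernel_le structured_vectors_card(1)[OF n]) auto
    also have "\<dots> \<le> ?T"
      using card_structured_vectors_times_power_le[OF n d q] unfolding e_def .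
    finally show "?P (E2 d) \<le> ?T" .
  qed
  also have "\<dots> = real (card I) * ?T" by simp
  also have "\<dots> \<le> real (n ^ a) * ?T"
  proof (intro mult_right_mono of_nat_mono)
    have "card I \<le> card {1..<n ^ a}" by (intro card_mono) (auto simp: I_def)
    thus "card I \<le> n ^ a" by simp
  qed auto
  finally show ?thesis by simp
qed

section \<open>Asymptotics\<close>

lemma power_nat_floor_le:
  assumes "1 \<le> b" "0 \<le> t"
  shows "b ^ nat \<lfloor>t\<rfloor> \<le> (b::real) powr t"
proof -
  have "b ^ nat \<lfloor>t\<rfloor> = b powr real (nat \<lfloor>t\<rfloor>)" using assms by (subst powr_realpow) auto
  also have "\<dots> \<le> b powr t" using assms by (intro powr_mono) linarith+
  finally show ?thesis .
qed

lemma sparse_count_le: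
  fixes b :: nat
  assumes n: "n \<ge> 3" and t: "0 \<le> t"
  shows "real ((n * (2 * n ^ b + 1)) ^ nat \<lfloor>t\<rfloor>) \<le> exp ((real b + 2) * (t * ln (real n)))"
proof -
  have "n * (2 * n ^ b + 1) \<le> n * (3 * n ^ b)"
    using n by (intro mult_le_mono2) simp
  also have "\<dots> \<le> n * (n * n ^ b)"
    using n by (intro mult_le_mono) auto
  also have "\<dots> = n ^ (b + 2)" by simp
  finally have "real ((n * (2 * n ^ b + 1)) ^ nat \<lfloor>t\<rfloor>) \<le> real ((n ^ (b + 2)) ^ nat \<lfloor>t\<rfloor>)"
    by (intro of_nat_mono power_mono) auto
  also have "\<dots> = (real n ^ (b + 2)) ^ nat \<lfloor>t\<rfloor>" by simp
  also have "\<dots> \<le> (real n ^ (b + 2)) powr t"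
    using n t by (intro power_nat_floor_le one_le_power) auto
  also have "\<dots> = exp (t * ln (real n ^ (b + 2)))"
    using n by (simp add: powr_def)
  also have "t * ln (real n ^ (b + 2)) = (real b + 2) * (t * ln (real n))"
    using n by (subst ln_realpow) auto
  finally show ?thesis .
qed

lemma sparse_kernel_bound_le:
  assumes n: "n \<ge> 3" and \<mu>: "0 < \<mu>" "\<mu> \<le> 1"
  shows "real ((n * (2 * n ^ 3 + 1)) ^ nat \<lfloor>real n powr (39/40)\<rfloor>) * (1 - \<mu> / 2) ^ (n - 1)
    \<le> exp (5 * (real n powr (39/40) * ln (real n)) - (- ln (1 - \<mu> / 2)) * (real n - 1))"
proof -
  have "(1 - \<mu> / 2) ^ (n - 1) = exp (real (n - 1) * ln (1 - \<mu> / 2))"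
    using \<mu> by (simp add: exp_of_nat_mult)
  moreover have "real (n - 1) = real n - 1" using n by simp
  ultimately have "(1 - \<mu> / 2) ^ (n - 1) = exp (- (- ln (1 - \<mu> / 2)) * (real n - 1))"
    by (simp add: mult.commute)
  moreover have "real ((n * (2 * n ^ 3 + 1)) ^ nat \<lfloor>real n powr (39/40)\<rfloor>)
      \<le> exp (5 * (real n powr (39/40) * ln (real n)))"
    using sparse_count_le[OF n, of "real n powr (39/40)" 3] by simp
  ultimately show ?thesis
    by (simp only: exp_add diff_conv_add_uminus mult_minus_left) (intro mult_right_mono, auto)
qed

lemma structured_kernel_bound_le:
  fixes a n :: nat
  defines "e \<equiv> nat \<lfloor>real n powr (39/40)\<rfloor>"
  assumes n: "n \<ge> 3"
  shows "real (n ^ a) * ((37632 * real n powr (- 3/20)) ^ n * real (n ^ a) ^ (e + 1)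
          * real ((n * (2 * n ^ (a + 3) + 1)) ^ e))
    \<le> exp (real n * (ln 37632 - 3/20 * ln (real n)) + real a * (real n powr (39/40) + 2) * ln (real n)
        + (real a + 5) * (real n powr (39/40) * ln (real n)))"
proof -
  let ?t = "real n powr (39/40)"
  have n0: "0 < real n" using n by simp
  have "(37632 * real n powr (- 3/20)) ^ n = exp (real n * (ln 37632 - 3/20 * ln (real n)))"
  proof -
    have "37632 * real n powr (- 3/20) = exp (ln 37632 - 3/20 * ln (real n))"
    proof -
      have "37632 * real n powr (- 3/20) = exp (ln 37632) * exp (- (3/20 * ln (real n)))"
        using n0 by (simp add: powr_def)
      also have "\<dots> = exp (ln 37632 + - (3/20 * ln (real n)))" by (rule exp_add[symmetric])
      finally show ?thesis by (simp only: diff_conv_add_uminus)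
    qed
    thus ?thesis by (simp add: exp_of_nat_mult)
  qed
  moreover have "real ((n * (2 * n ^ (a + 3) + 1)) ^ e) \<le> exp ((real a + 5) * (?t * ln (real n)))"
    using sparse_count_le[OF n, of ?t "a + 3"] by (simp add: e_def add.commute)
  moreover have "real (n ^ a) * real (n ^ a) ^ (e + 1) \<le> exp (real a * (?t + 2) * ln (real n))"
  proof -
    have na: "1 \<le> real (n ^ a)" using n by simp
    have "real (n ^ a) * real (n ^ a) ^ (e + 1) = real (n ^ a) ^ 2 * real (n ^ a) ^ e"
      by (simp add: power2_eq_square)
    also have "\<dots> \<le> real (n ^ a) powr 2 * real (n ^ a) powr ?t"
      unfolding e_def using na by (intro mult_mono power_nat_floor_le) auto
    also have "\<dots> = real (n ^ a) powr (?t + 2)"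
      by (simp only: powr_add mult.commute)
    also have "\<dots> = exp ((?t + 2) * ln (real n ^ a))"
      using n0 by (simp add: powr_def)
    also have "(?t + 2) * ln (real n ^ a) = real a * (?t + 2) * ln (real n)"
      using n0 by (simp add: ln_realpow)
    finally show ?thesis .
  qed
  ultimately have "(37632 * real n powr (- 3/20)) ^ n * (real (n ^ a) * real (n ^ a) ^ (e + 1))
        * real ((n * (2 * n ^ (a + 3) + 1)) ^ e)
     \<le> exp (real n * (ln 37632 - 3/20 * ln (real n))) * exp (real a * (?t + 2) * ln (real n))
        * exp ((real a + 5) * (?t * ln (real n)))"
    by (intro mult_mono mult_nonneg_nonneg) simp_all
  thus ?thesis by (simp only: exp_add mult_ac)
qed

text \<open>
  The exponent \<open>a\<close> governs the number \<open>n ^ a\<close> of lattice multiples inspected. It has to exceed the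
  window length \<open>n powr (11/20)\<close> divided by the concentration \<open>n powr (- A - 1) / 2\<close>.
\<close>

lemma eventually_sufficiently_large:
  assumes \<mu>: "0 < \<mu>" and a: "A + 2 \<le> real a"
  shows "\<forall>\<^sub>F n in sequentially. sufficiently_large \<mu> a (real n powr (- A - 1) / 2) n"
proof -
  have c: "\<mu>\<^sup>2 / 2 > 0" using \<mu> by simp
  have "\<forall>\<^sub>F n in sequentially. 8 * (real n powr (11/20) + 1) * real n powr (- A - 2)
      + 8 * exp (- (\<mu>\<^sup>2 / 2) * real n powr (1/40)) < real n powr (- A - 1) / 2"
    using c by real_asymp
  moreover have "\<forall>\<^sub>F n in sequentially. 48 * real n powr (11/40) * (real n powr (11/20) + 1)
      + real n powr (real a) * (8 * exp (- (\<mu>\<^sup>2 / 2) * real n powr (1/40))) \<le> 98 * real n powr (33/40)"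
    using c by real_asymp
  moreover have "\<forall>\<^sub>F n in sequentially. 1 < 1 / real n ^ 3 * (real n powr (1/40)) ^ 121"
    by real_asymp
  moreover have "\<forall>\<^sub>F n in sequentially. 12 * real n powr (1/40)
      < (real n powr (11/20) / real n)\<^sup>2 * (real n powr (39/40) / 2 ^ 121)"
    by real_asymp
  moreover have "\<forall>\<^sub>F n in sequentially. 24 * real n powr (1/40) \<le> real n * (real n powr (- 1/4))\<^sup>2"
    by real_asymp
  moreover have "\<forall>\<^sub>F n in sequentially. real n * (real n powr (- 1/4))\<^sup>2 \<le> (real n powr (11/40))\<^sup>2"
    by real_asymp
  moreover have "\<forall>\<^sub>F n in sequentially. 3 * real n powr (11/40) \<le> real n powr (11/20)"
    by real_asymp
  moreover have "\<forall>\<^sub>F n in sequentially. real n ^ 2 / real n powr (- 1/4) + 1 \<le> real n ^ 3"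
    by real_asymp
  moreover have "\<forall>\<^sub>F n in sequentially. real n * real n * (real n powr (- 1/4))\<^sup>2 / (real n powr (11/40))\<^sup>2
      \<le> real n powr (39/40)"
    by real_asymp
  moreover have "\<forall>\<^sub>F n in sequentially. n \<ge> 2" by (rule eventually_ge_at_top)
  ultimately show ?thesis
  proof eventually_elim
    case (elim n)
    have n: "1 < real n" using elim(10) by simp
    have na: "real n ^ a = real n powr (real a)" using n by (simp add: powr_realpow)
    have "1 / real n ^ a \<le> real n powr (- A - 2)"
    proof -
      have "1 / real n ^ a = real n powr (- real a)" by (simp add: na powr_minus divide_inverse)
      also have "\<dots> \<le> real n powr (- A - 2)" using n a by (intro powr_mono) auto
      finally show ?thesis .
    qed
    hence "8 * (real n powr (11/20) + 1) * (1 / real n ^ a) \<le> 8 * (real n powr (11/20) + 1) * real n powr (- A - 2)"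
      by (intro mult_left_mono) auto
    moreover have "8 * (real n powr (11/20) + 1) / real n ^ a = 8 * (real n powr (11/20) + 1) * (1 / real n ^ a)"
      by simp
    ultimately have 1: "8 * (real n powr (11/20) + 1) / real n ^ a + 8 * exp (- (\<mu>\<^sup>2 / 2) * real n powr (1/40))
        < real n powr (- A - 1) / 2"
      using elim(1) by linarith
    have 2: "real n ^ a * real n ^ 2 / real n powr (- 1/4) + 1 \<le> real n ^ (a + 3)"
    proof -
      have na1: "1 \<le> real n ^ a" using n by simp
      have "real n ^ a * real n ^ 2 / real n powr (- 1/4) + 1
          \<le> real n ^ a * (real n ^ 2 / real n powr (- 1/4)) + real n ^ a * 1"
        using na1 by simp
      also have "\<dots> = real n ^ a * (real n ^ 2 / real n powr (- 1/4) + 1)"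
        by (simp only: distrib_left)
      also have "\<dots> \<le> real n ^ a * real n ^ 3"
        using elim(8) na1 by (intro mult_left_mono) auto
      finally show ?thesis by (simp only: power_add)
    qed
    show ?case
      unfolding sufficiently_large_def using elim 1 2 by (intro conjI) (simp_all only: na)
  qed
qed

theorem theorem3p4:
  fixes A :: real
  assumes "A > 0"
  shows "\<exists>B > 0. \<forall>\<mu> :: real. 0 < \<mu> \<and> \<mu> \<le> 1 \<longrightarrow>
    (\<forall>\<^sub>F n in sequentially.
       measure_pmf.prob (random_matrix_pmf \<mu> n)
         {M. smallest_singular_value n M \<le> real n powr (- B)} \<le> real n powr (- A))"
proof -
  define a where "a = nat \<lceil>A\<rceil> + 2"
  \<comment> \<open>At scale \<open>1 / n\<close>, the \<open>n ^ a\<close> multiples resolve intervals of width about \<open>n powr (1 - a)\<close>. The vector has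
    been rescaled by up to \<open>n ^ 3\<close>, and passing from \<open>n powr - B\<close> to an inner product costs a factor \<open>n\<close>.\<close>
  define B where "B = real a + 4"
  have a: "A + 2 \<le> real a" unfolding a_def by linarith
  have "\<forall>\<^sub>F n in sequentially.
       measure_pmf.prob (random_matrix_pmf \<mu> n)
         {M. smallest_singular_value n M \<le> real n powr (- B)} \<le> real n powr (- A)"
    if \<mu>: "0 < \<mu>" "\<mu> \<le> 1" for \<mu>
  proof -
    define c where "c = - ln (1 - \<mu> / 2)"
    have c: "c > 0" unfolding c_def using \<mu> by (simp add: ln_less_zero)
    have "\<forall>\<^sub>F n in sequentially.
        exp (5 * (real n powr (39/40) * ln (real n)) - c * (real n - 1)) \<le> real n powr (- A - 1) / 4"
      using c by real_asymp
    moreover have "\<forall>\<^sub>F n in sequentially.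
        exp (real n * (ln 37632 - 3/20 * ln (real n)) + real a * (real n powr (39/40) + 2) * ln (real n)
          + (real a + 5) * (real n powr (39/40) * ln (real n))) \<le> real n powr (- A - 1) / 4"
      by real_asymp
    moreover have "\<forall>\<^sub>F n in sequentially. 196 * real n powr (33/40) \<le> real n powr (39/40)"
      by real_asymp
    moreover have "\<forall>\<^sub>F n in sequentially. n \<ge> 3" by (rule eventually_ge_at_top)
    moreover note eventually_sufficiently_large[OF \<mu>(1) a]
    ultimately show ?thesis
    proof eventually_elim
      case (elim n)
      define p where "p = real n powr (- A - 1) / 2"
      have n: "n > 0" "3 \<le> real n" using elim(4) by auto
      have \<epsilon>: "real n * real n powr (- B) * real n ^ 3 \<le> real n / (3 * real n ^ a)"
      proof -
        have "real n powr (- B) = 1 / (real n ^ a * real n ^ 4)"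
        proof -
          have "real n powr (- B) = inverse (real n powr real (a + 4))"
            by (simp add: B_def flip: powr_minus)
          also have "real n powr real (a + 4) = real n ^ (a + 4)"
            using n by (intro powr_realpow) simp
          finally show ?thesis by (simp only: power_add inverse_eq_divide)
        qed
        hence "real n * real n powr (- B) * real n ^ 3 = 1 / real n ^ a"
          using n by (simp add: field_simps power_numeral_reduce)
        also have "\<dots> \<le> real n / 3 * (1 / real n ^ a)"
          using n mult_right_mono[of 1 "real n / 3" "1 / real n ^ a"] by simp
        finally show ?thesis by simp
      qed
      have "measure_pmf.prob (columns_pmf \<mu> n) (rich_normal_event \<mu> n i (real n * real n powr (- B)) p) \<le> p"
        if i: "i < n" for i
      proof -
        have \<mu>0: "0 \<le> \<mu>" using \<mu> by simp
        note prob_rich_normal_le[OF \<mu>0 \<mu>(2) i \<epsilon> elim(5) elim(3)]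
        moreover note sparse_kernel_bound_le[OF elim(4) \<mu>, folded c_def]
        moreover note structured_kernel_bound_le[OF elim(4), of a]
        ultimately show ?thesis using elim(1,2) unfolding p_def by linarith
      qed
      hence "measure_pmf.prob (random_matrix_pmf \<mu> n) {M. smallest_singular_value n M \<le> real n powr (- B)}
          \<le> real n * (p + p)"
        using n by (intro prob_small_singular_value_le) (auto simp: p_def)
      also have "\<dots> = real n powr 1 * real n powr (- A - 1)" using n by (simp add: p_def)
      also have "\<dots> = real n powr (1 + (- A - 1))" by (rule powr_add[symmetric])
      also have "\<dots> = real n powr (- A)" by simp
      finally show ?case .
    qed
  qed
  moreover have "B > 0" by (simp add: B_def)
  ultimately show ?thesis by blast
qed

end
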